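(* Let $(X,d)$ be a length space and let $F:Y\to\mathbb{R}$ be Lipschitz, where $\emptyset\neq Y\subset X$. If $\inf F>-\infty$, then the continuum value $u$ of $(X,d,Y,F,f)$ with $f=0$ is an AM (absolutely minimal) extension of $F$. If $F$ is also bounded, then $u$ is the unique AM extension of $F$.
   Context: A metric space $(X,d)$ is a length space if for all $x,y\in X$, $d(x,y)$ is the infimum of the lengths of continuous paths in $X$ connecting $x$ to $y$. For $W\subset X$ and a real function $u$ defined on $W$, $\mathrm{Lip}_W u=\sup\{|u(y)-u(x)|/d(x,y):x,y\in W,\ x\neq y\}$. A function $u:X\to\mathbb{R}$ is an absolutely minimal (AM) extension of $F:Y\to\mathbb{R}$ if $u=F$ on $Y$, $\mathrm{Lip}_X u<\infty$, and $\mathrm{Lip}_U u=\mathrm{Lip}_{\partial U}u$ for every open set $U\subset X\setminus Y$. Continuum value (case $f=0$). For $\varepsilon>0$ and $x\in X$, in $\varepsilon$-tug-of-war a token starts at $x_0=x$; at the $k$-th turn a fair coin is tossed (independently) and the winner of the toss chooses $x_k\in X$ with $d(x_k,x_{k-1})<\varepsilon$. The game ends the first time $x_k\in Y$, and player I's payoff is then $F(x_k)$. Player I maximizes and player II minimizes. A strategy is a map from the set of partially played games (all previous moves and coin tosses) to legal moves (or to probability distributions on legal moves). For strategies $S_{\mathrm I},S_{\mathrm{II}}$, if the game terminates with probability one and the expected payoff exists in $[-\infty,\infty]$, then $F_-(S_{\mathrm I},S_{\mathrm{II}})=F_+(S_{\mathrm I},S_{\mathrm{II}})$ is this expectation; otherwise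 $F_-=-\infty$ and $F_+=+\infty$. Put $u_{\mathrm I}^\varepsilon(x)=\sup_{S_{\mathrm I}}\inf_{S_{\mathrm{II}}}F_-$ and $u_{\mathrm{II}}^\varepsilon(x)=\inf_{S_{\mathrm{II}}}\sup_{S_{\mathrm I}}F_+$; when these agree the common function is $u^\varepsilon$. The continuum value is the pointwise limit $u=\lim_{\varepsilon\to0}u^\varepsilon$ (it exists under the hypotheses of the claim). *)

theory Defs
  imports "HOL-Analysis.Analysis" "HOL-Probability.Probability"
begin

section \<open>Length spaces\<close>

definition path_length :: "(real \<Rightarrow> 'a::metric_space) \<Rightarrow> ennreal" where
  "path_length p =
     (SUP (n, t) \<in> {(n :: nat, t :: nat \<Rightarrow> real).
                      (\<forall>i\<le>n. t i \<in> {0..1}) \<and> (\<forall>i<n. t i \<le> t (Suc i))}.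
        \<Sum>i<n. ennreal (dist (p (t i)) (p (t (Suc i)))))"

definition length_space :: "'a::metric_space itself \<Rightarrow> bool" where
  "length_space _ \<longleftrightarrow>
     (\<forall>x y :: 'a. ennreal (dist x y) =
        (INF p \<in> {p. path p \<and> pathstart p = x \<and> pathfinish p = y}. path_length p))"


section \<open>Absolutely minimal extensions\<close>

text \<open>The supremum is taken in \<open>[0, \<infinity>]\<close>, so it is \<open>0\<close> if \<open>W\<close> has at most one point.\<close>

definition Lip :: "'a::metric_space set \<Rightarrow> ('a \<Rightarrow> real) \<Rightarrow> ennreal" where
  "Lip W u = (SUP (x, y) \<in> {(x, y). x \<in> W \<and> y \<in> W \<and> x \<noteq> y}.
                ennreal (\<bar>u y - u x\<bar> / dist x y))"

definition AM_extension ::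
    "'a::metric_space set \<Rightarrow> ('a \<Rightarrow> real) \<Rightarrow> ('a \<Rightarrow> real) \<Rightarrow> bool" where
  "AM_extension Y F u \<longleftrightarrow>
     (\<forall>y\<in>Y. u y = F y) \<and> Lip UNIV u < \<infinity> \<and>
     (\<forall>U. open U \<longrightarrow> U \<subseteq> UNIV - Y \<longrightarrow> Lip U u = Lip (frontier U) u)"


section \<open>Tug-of-war\<close>

text \<open>
  A partially played game consists of the starting position and of the turns played so far,
  most recent first. A turn \<open>(b, x)\<close> records the result of the coin toss (\<open>b\<close> is true iff player I
  won it) and the position \<open>x\<close> that the winner moved to.
\<close>

type_synonym 'a partial_game = "'a \<times> (bool \<times> 'a) list"

definition position :: "'a partial_game \<Rightarrow> 'a" where
  "position h = (case snd h of [] \<Rightarrow> fst h | (b, x) # _ \<Rightarrow> x)"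

definition extend_game :: "'a partial_game \<Rightarrow> bool \<Rightarrow> 'a \<Rightarrow> 'a partial_game" where
  "extend_game h b x = (fst h, (b, x) # snd h)"

text \<open>
  A strategy maps every partially played game to a probability distribution on legal moves;
  strategies that choose a move outright are those whose values are of the form \<open>return_pmf x\<close>.
  The dependence on the partially played game is not subject to any measurability
  condition, so the distributions have to be discrete for every pair of strategies to determine
  a law of the play.
\<close>

type_synonym 'a strategy = "'a partial_game \<Rightarrow> 'a pmf"

definition strategies :: "real \<Rightarrow> 'a::metric_space strategy set" where
  "strategies \<epsilon> = {S. \<forall>h. set_pmf (S h) \<subseteq> {x. dist x (position h) < \<epsilon>}}"

text \<open>
  \<open>final_position Y S T h\<close> is the distribution of the position at which the game ends when it is
  continued from \<open>h\<close>, player I using \<open>S\<close> and player II using \<open>T\<close>. It is the least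
  sub-probability distribution satisfying the recursion below, so the mass it lacks is the
  probability that the game never ends; it is \<open>lossless_spmf\<close> iff the game ends with
  probability one.
\<close>

partial_function (spmf) final_position ::
    "'a set \<Rightarrow> 'a strategy \<Rightarrow> 'a strategy \<Rightarrow> 'a partial_game \<Rightarrow> 'a spmf" where
  "final_position Y S T h =
     (if position h \<in> Y then return_spmf (position h)
      else bind_spmf coin_spmf (\<lambda>b.
             bind_spmf (spmf_of_pmf (if b then S h else T h)) (\<lambda>x.
               final_position Y S T (extend_game h b x))))"

definition pos_expectation :: "'a spmf \<Rightarrow> ('a \<Rightarrow> real) \<Rightarrow> ennreal" where
  "pos_expectation p F = (\<integral>\<^sup>+x. ennreal (max 0 (F x)) \<partial>measure_spmf p)"

definition expectation_exists :: "'a spmf \<Rightarrow> ('a \<Rightarrow> real) \<Rightarrow> bool" where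
  "expectation_exists p F \<longleftrightarrow>
     pos_expectation p F < \<infinity> \<or> pos_expectation p (\<lambda>x. - F x) < \<infinity>"

definition ext_expectation :: "'a spmf \<Rightarrow> ('a \<Rightarrow> real) \<Rightarrow> ereal" where
  "ext_expectation p F =
     enn2ereal (pos_expectation p F) - enn2ereal (pos_expectation p (\<lambda>x. - F x))"

definition F_minus ::
    "'a set \<Rightarrow> ('a \<Rightarrow> real) \<Rightarrow> 'a \<Rightarrow> 'a strategy \<Rightarrow> 'a strategy \<Rightarrow> ereal" where
  "F_minus Y F x S T =
     (let p = final_position Y S T (x, [])
      in if lossless_spmf p \<and> expectation_exists p F then ext_expectation p F else -\<infinity>)"

definition F_plus ::
    "'a set \<Rightarrow> ('a \<Rightarrow> real) \<Rightarrow> 'a \<Rightarrow> 'a strategy \<Rightarrow> 'a strategy \<Rightarrow> ereal" where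
  "F_plus Y F x S T =
     (let p = final_position Y S T (x, [])
      in if lossless_spmf p \<and> expectation_exists p F then ext_expectation p F else \<infinity>)"

definition value_I :: "'a::metric_space set \<Rightarrow> ('a \<Rightarrow> real) \<Rightarrow> real \<Rightarrow> 'a \<Rightarrow> ereal" where
  "value_I Y F \<epsilon> x = (SUP S \<in> strategies \<epsilon>. INF T \<in> strategies \<epsilon>. F_minus Y F x S T)"

definition value_II :: "'a::metric_space set \<Rightarrow> ('a \<Rightarrow> real) \<Rightarrow> real \<Rightarrow> 'a \<Rightarrow> ereal" where
  "value_II Y F \<epsilon> x = (INF T \<in> strategies \<epsilon>. SUP S \<in> strategies \<epsilon>. F_plus Y F x S T)"

text \<open>
  The limit defining the continuum value presupposes that the \<open>\<epsilon>\<close>-game has a value, i.e.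
  that both players' values agree, once \<open>\<epsilon>\<close> is small enough. The running payoff is zero.
\<close>

definition is_continuum_value ::
    "'a::metric_space set \<Rightarrow> ('a \<Rightarrow> real) \<Rightarrow> ('a \<Rightarrow> real) \<Rightarrow> bool" where
  "is_continuum_value Y F u \<longleftrightarrow>
     (\<forall>\<^sub>F \<epsilon> in at_right 0. value_I Y F \<epsilon> = value_II Y F \<epsilon>) \<and>
     (\<forall>x. ((\<lambda>\<epsilon>. value_I Y F \<epsilon> x) \<longlongrightarrow> ereal (u x)) (at_right 0))"

end

theory Submission
  imports Defs
begin

text \<open>
  The value of the \<open>\<epsilon>\<close>-game is the least function \<open>u\<close> that is bounded below, at least \<open>F\<close> on \<open>Y\<close>, and
  superharmonic on scale \<open>\<epsilon>\<close>: the average of its supremum and its infimum over the \<open>\<epsilon>\<close>-ball about a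
  point outside \<open>Y\<close> is at most its value there. Player II achieves any such function by descending
  along it, once it has been modified so that it descends by a definite amount everywhere, which makes
  the game end; and player I's value is itself such a function.

  Taking the minimum over a ball makes a function that is superharmonic on scale \<open>s\<close> superharmonic on
  multiples of \<open>s\<close>; interpolating by cones leads back from scale \<open>2 s\<close> to \<open>s\<close>. Both change the
  function by \<open>O(s)\<close>, so the values converge uniformly. The limit satisfies the cone bounds of an
  absolutely minimal extension: from above because it is least, from below because steepest descents
  would otherwise never end. Conversely the minima over small balls of an absolutely minimal extension
  are superharmonic, so for bounded \<open>F\<close> it dominates the limit; with \<open>-F\<close> in place of \<open>F\<close> and a
  comparison principle for the game this yields uniqueness.
\<close>

section \<open>Length spaces\<close>

text \<open>Near-minima take their place, with errors that have to be summed, and contradictions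
  come from descents that would pass below the lower bound \<open>m\<close>. A play that never ends
  counts against player I in \<open>F_minus\<close> and against player II in \<open>F_plus\<close>,
  so each player's strategy has to force termination itself. On a fixed scale \<open>u\<close> may
  jump and is Lipschitz only up to an error proportional to the scale. Distances are therefore
  counted in moves. The numerical constants only have to keep all errors linear in the scale, since
  that makes the errors summable over repeated halving.\<close>

lemma length_space_path:
  fixes x y :: "'a::metric_space"
  assumes len: "length_space TYPE('a)" and e: "dist x y < e"
  obtains p where "path p" "pathstart p = x" "pathfinish p = y"
    "\<And>t. t \<in> {0..1} \<Longrightarrow> dist x (p t) + dist (p t) y < e"
proof -
  have "(INF p \<in> {p. path p \<and> pathstart p = x \<and> pathfinish p = y}. path_length p) < ennreal e"
    using len e unfolding length_space_def by (metis ennreal_less_iff zero_le_dist)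
  then obtain p where p: "path p" "pathstart p = x" "pathfinish p = y" and l: "path_length p < ennreal e"
    by (auto simp: INF_less_iff)
  have "dist x (p t) + dist (p t) y < e" if t: "t \<in> {0..1}" for t
  proof -
    define \<tau> :: "nat \<Rightarrow> real" where "\<tau> = (\<lambda>i. if i = 0 then 0 else if i = 1 then t else 1)"
    have "(\<Sum>i<2. ennreal (dist (p (\<tau> i)) (p (\<tau> (Suc i))))) \<le> path_length p"
      unfolding path_length_def
      by (rule SUP_upper2[where i="(2, \<tau>)"]) (use t in \<open>auto simp: \<tau>_def\<close>)
    moreover have "(\<Sum>i<2. ennreal (dist (p (\<tau> i)) (p (\<tau> (Suc i))))) = ennreal (dist x (p t) + dist (p t) y)"
      using p by (simp add: numeral_2_eq_2 \<tau>_def pathstart_def pathfinish_def ennreal_plus)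
    ultimately have "ennreal (dist x (p t) + dist (p t) y) < ennreal e"
      using l by (metis order_le_less_trans)
    then show ?thesis using ennreal_less_iff[of "dist x (p t) + dist (p t) y"] by simp
  qed
  with p that show thesis by blast
qed

text \<open>Radii add up as in a geodesic space, which is why \<open>lo a\<close> after
  \<open>lo b\<close> is \<open>lo (a + b)\<close>. The intermediate value theorem finds the
  dividing point on an almost shortest path.\<close>

lemma length_space_split:
  fixes x z :: "'a::metric_space"
  assumes len: "length_space TYPE('a)" and d: "dist x z < a + b" and a: "0 < a" and b: "0 < b"
  obtains p where "dist x p < a" "dist p z < b"
proof (cases "dist x z < a")
  case True
  with b that[of z] show thesis by simp
next
  case False
  obtain p where p: "path p" "pathstart p = x" "pathfinish p = z"
    "\<And>t. t \<in> {0..1} \<Longrightarrow> dist x (p t) + dist (p t) z < a + b"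
    using length_space_path[OF len d] by blast
  have cont: "continuous_on {0..1} (\<lambda>t. dist x (p t))"
    using p(1) unfolding path_def by (intro continuous_intros)
  \<comment> \<open>Compactness turns the pointwise strict bound into a uniform
    \<open>D < a + b\<close>; this slack leaves room for a radius \<open>r\<close> with
    \<open>D - b < r < a\<close>.\<close>
  have "compact ((\<lambda>t. dist x (p t) + dist (p t) z) ` {0..1::real})"
    using p(1) unfolding path_def by (intro compact_continuous_image continuous_intros compact_Icc)
  then obtain D where D: "D < a + b" "\<And>t. t \<in> {0..1} \<Longrightarrow> dist x (p t) + dist (p t) z \<le> D"
  proof -
    assume "compact ((\<lambda>t. dist x (p t) + dist (p t) z) ` {0..1::real})"
    then obtain s where "s \<in> (\<lambda>t. dist x (p t) + dist (p t) z) ` {0..1::real}"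
      "\<forall>t\<in>(\<lambda>t. dist x (p t) + dist (p t) z) ` {0..1::real}. t \<le> s"
      using compact_attains_sup[of "(\<lambda>t. dist x (p t) + dist (p t) z) ` {0..1::real}"] by auto
    then show thesis using p(4) by (intro that[of s]) auto
  qed
  define r where "r = (max 0 (D - b) + a) / 2"
  have r: "0 \<le> r" "r < a" "D - r < b" using D(1) a unfolding r_def by (auto simp: max_def field_simps)
  have "\<exists>t\<ge>0. t \<le> 1 \<and> dist x (p t) = r"
    by (rule IVT') (use p r False cont in \<open>auto simp: pathstart_def pathfinish_def\<close>)
  then obtain t where t: "t \<in> {0..1}" "dist x (p t) = r" by auto
  have "dist (p t) z \<le> D - r" using D(2)[OF t(1)] t(2) by simp
  then show thesis using that[of "p t"] t(2) r by simp
qed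

lemma length_space_cross_frontier:
  fixes x y :: "'a::metric_space"
  assumes len: "length_space TYPE('a)" and "y \<in> V" "x \<notin> V" and e: "dist y x < e"
  obtains c where "c \<in> frontier V" "dist y c + dist c x < e"
proof -
  obtain p where p: "path p" "pathstart p = y" "pathfinish p = x"
    "\<And>t. t \<in> {0..1} \<Longrightarrow> dist y (p t) + dist (p t) x < e"
    using length_space_path[OF len e] by blast
  have "y \<in> path_image p" "x \<in> path_image p"
    using p by (metis pathstart_in_path_image, metis pathfinish_in_path_image)
  then have "path_image p \<inter> frontier V \<noteq> {}"
    using assms(2,3) connected_Int_frontier[OF connected_path_image[OF p(1)], of V] by blast
  then obtain t where "t \<in> {0..1}" "p t \<in> frontier V" unfolding path_image_def by blast
  with p(4) that show thesis by blast
qed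

text \<open>The least number of moves of length less than \<open>s\<close> that lead from \<open>x\<close> to \<open>z\<close>.\<close>

definition steps :: "real \<Rightarrow> 'a::metric_space \<Rightarrow> 'a \<Rightarrow> nat" where
  "steps s x z = (if x = z then 0 else nat \<lfloor>dist x z / s\<rfloor> + 1)"

lemma steps_self [simp]: "steps s x x = 0"
  by (simp add: steps_def)

lemma steps_eq_0_iff [simp]: "steps s x z = 0 \<longleftrightarrow> x = z"
  by (simp add: steps_def)

lemma steps_commute: "steps s x z = steps s z x"
  by (simp add: steps_def dist_commute)

lemma steps_le_iff:
  assumes "0 < s" "0 < k"
  shows "steps s x z \<le> k \<longleftrightarrow> dist x z < real k * s"
proof (cases "x = z")
  case True with assms show ?thesis by simp
next
  case False
  have "steps s x z \<le> k \<longleftrightarrow> nat \<lfloor>dist x z / s\<rfloor> < k" using False by (simp add: steps_def Suc_le_eq)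
  also have "\<dots> \<longleftrightarrow> \<lfloor>dist x z / s\<rfloor> < int k" using assms by (simp add: nat_less_iff) 
  also have "\<dots> \<longleftrightarrow> dist x z / s < real k" by (simp add: floor_less_iff)
  also have "\<dots> \<longleftrightarrow> dist x z < real k * s" using assms by (simp add: pos_divide_less_eq)
  finally show ?thesis .
qed

lemma dist_le_steps:
  assumes "0 < s" shows "dist x z \<le> s * real (steps s x z)"
proof (cases "x = z")
  case False
  then have "0 < steps s x z" by (simp add: zero_less_iff_neq_zero)
  from steps_le_iff[OF assms this, of x z] show ?thesis by (simp add: mult.commute less_imp_le)
qed simp

lemma steps_le_dist:
  assumes "0 < s" shows "s * real (steps s x z) \<le> dist x z + s"
proof (cases "x = z")
  case False
  define n where "n = nat \<lfloor>dist x z / s\<rfloor>"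
  have "real n \<le> dist x z / s" unfolding n_def using assms by (intro of_nat_floor) simp
  then have "s * real n \<le> dist x z" using assms by (simp add: pos_le_divide_eq mult.commute)
  moreover have "steps s x z = n + 1" using False by (simp add: steps_def n_def)
  ultimately show ?thesis by (simp add: distrib_left)
qed (use assms in simp)

lemma steps_triangle_1:
  assumes "0 < s" "dist x p < s" shows "steps s x z \<le> Suc (steps s p z)"
proof (cases "p = z")
  case True
  then show ?thesis using assms steps_le_iff[of s 1 x z] by simp
next
  case False
  then have pos: "0 < steps s p z" by (simp add: zero_less_iff_neq_zero)
  then have "dist p z < real (steps s p z) * s" using steps_le_iff[OF assms(1) pos, of p z] by simp
  then have "dist x z < real (Suc (steps s p z)) * s" using assms(2) dist_triangle[of x z p]
    by (simp add: algebra_simps)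
  then show ?thesis using steps_le_iff[OF assms(1), of "Suc (steps s p z)" x z] by simp
qed

lemma steps_descend:
  fixes x z :: "'a::metric_space"
  assumes len: "length_space TYPE('a)" and s: "0 < s" and "x \<noteq> z"
  obtains p where "dist x p < s" "Suc (steps s p z) \<le> steps s x z"
proof (cases "steps s x z = 1")
  case True
  then have "dist x z < s" using steps_le_iff[OF s, of 1 x z] by simp
  then show thesis using that[of z] True by simp
next
  case False
  then obtain k where k: "steps s x z = Suc k" "0 < k"
    using \<open>x \<noteq> z\<close> by (metis One_nat_def not0_implies_Suc not_gr0 steps_eq_0_iff)
  then have "dist x z < s + real k * s" using steps_le_iff[OF s, of "Suc k" x z] by (simp add: algebra_simps)
  then obtain p where "dist x p < s" "dist p z < real k * s"
    using length_space_split[OF len, of x z s "real k * s"] s k by auto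
  then show thesis using that[of p] steps_le_iff[OF s k(2), of p z] k by simp
qed

section \<open>Superharmonic functions on a fixed scale\<close>

definition lo :: "real \<Rightarrow> ('a::metric_space \<Rightarrow> real) \<Rightarrow> 'a \<Rightarrow> real" where
  "lo s w x = (INF y \<in> ball x s. w y)"

text \<open>The supremum over the ball is expressed by quantifying over \<open>p\<close>, since
  \<open>w\<close> may be unbounded above there and a real \<open>SUP\<close> would be meaningless.
  The infimum \<open>lo\<close> makes sense once \<open>w\<close> has a lower bound, whence the
  \<open>m\<close> in the lemmas below.\<close>

definition superharmonic_at :: "real \<Rightarrow> ('a::metric_space \<Rightarrow> real) \<Rightarrow> 'a \<Rightarrow> bool" where
  "superharmonic_at s w x \<longleftrightarrow> (\<forall>p. dist x p < s \<longrightarrow> w p + lo s w x \<le> 2 * w x)"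

lemma superharmonic_atD: "superharmonic_at s w x \<Longrightarrow> dist x p < s \<Longrightarrow> w p + lo s w x \<le> 2 * w x"
  by (simp add: superharmonic_at_def)

lemma lo_le: "\<forall>x. m \<le> w x \<Longrightarrow> dist x y < s \<Longrightarrow> lo s w x \<le> w y"
  unfolding lo_def by (intro cINF_lower bdd_belowI[of _ m]) auto

lemma lo_greatest: "0 < s \<Longrightarrow> (\<And>y. dist x y < s \<Longrightarrow> c \<le> w y) \<Longrightarrow> c \<le> lo s w x"
  unfolding lo_def by (intro cINF_greatest) auto

lemma lo_le_self: "\<forall>x. m \<le> w x \<Longrightarrow> 0 < s \<Longrightarrow> lo s w x \<le> w x"
  by (rule lo_le[where m=m]) simp_all

lemma lo_less:
  assumes "0 < s" "lo s w x < c"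
  obtains y where "dist x y < s" "w y < c"
  using lo_greatest[of s x c w] assms by (meson leD le_less_linear not_le)

lemma lo_mono:
  assumes "0 < s" "\<forall>x. m \<le> v x" "\<And>y. dist x y < s \<Longrightarrow> v y \<le> w y"
  shows "lo s v x \<le> lo s w x"
  by (rule lo_greatest) (use assms lo_le[of m v x _ s] in \<open>auto intro: order_trans\<close>)

lemma lo_lo:
  fixes w :: "'a::metric_space \<Rightarrow> real"
  assumes len: "length_space TYPE('a)" and m: "\<forall>x. m \<le> w x" and ab: "0 < a" "0 < b"
  shows "lo a (lo b w) x = lo (a + b) w x"
proof (rule antisym)
  have m': "\<forall>y. m \<le> lo b w y" using m ab by (auto intro: lo_greatest)
  show "lo a (lo b w) x \<le> lo (a + b) w x"
  proof (rule lo_greatest)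
    fix y assume "dist x y < a + b"
    then obtain p where p: "dist x p < a" "dist p y < b" using length_space_split[OF len] ab by metis
    show "lo a (lo b w) x \<le> w y"
      using lo_le[OF m' p(1)] lo_le[OF m p(2)] by linarith
  qed (use ab in simp)
  show "lo (a + b) w x \<le> lo a (lo b w) x"
  proof (intro lo_greatest ab)
    fix y z assume "dist x y < a" "dist y z < b"
    then have "dist x z < a + b" using dist_triangle[of x z y] by linarith
    then show "lo (a + b) w x \<le> w z" by (rule lo_le[OF m])
  qed
qed

text \<open>Touching from below: \<open>h\<close> agrees with \<open>w\<close> at \<open>x\<close>
  and is no larger nearby, so the left side can only drop. This justifies gluing supersolutions by
  minima.\<close>

lemma superharmonic_at_min:
  assumes s: "0 < s" and m: "\<forall>x. m \<le> h x" and "superharmonic_at s w x" "h x = w x"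
    and le: "\<And>y. dist x y < s \<Longrightarrow> h y \<le> w y"
  shows "superharmonic_at s h x"
  unfolding superharmonic_at_def
proof (intro allI impI)
  fix p assume p: "dist x p < s"
  have "lo s h x \<le> lo s w x" by (rule lo_mono[OF s m le])
  then show "h p + lo s h x \<le> 2 * h x"
    using superharmonic_atD[OF assms(3) p] le[OF p] assms(4) by linarith
qed

lemma superharmonic_at_INF:
  assumes s: "0 < s" and "W \<noteq> {}" and m: "\<forall>w\<in>W. \<forall>y. m \<le> w y"
    and sh: "\<And>w. w \<in> W \<Longrightarrow> superharmonic_at s w x"
  shows "superharmonic_at s (\<lambda>y. INF w\<in>W. w y) x"
  unfolding superharmonic_at_def
proof (intro allI impI)
  let ?h = "\<lambda>y. INF w\<in>W. w y"
  fix p assume p: "dist x p < s"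
  have bd: "bdd_below ((\<lambda>w. w y) ` W)" for y by (intro bdd_belowI[of _ m]) (use m in auto)
  have mh: "\<forall>y. m \<le> ?h y" using assms(2) m by (auto intro: cINF_greatest)
  have "(?h p + lo s ?h x) / 2 \<le> ?h x"
  proof (intro cINF_greatest assms(2))
    fix w assume w: "w \<in> W"
    have le: "?h y \<le> w y" for y by (rule cINF_lower[OF bd w])
    have "lo s ?h x \<le> lo s w x" by (rule lo_mono[OF s mh le])
    then show "(?h p + lo s ?h x) / 2 \<le> w x"
      using superharmonic_atD[OF sh[OF w] p] le[of p] by argo
  qed
  then show "?h p + lo s ?h x \<le> 2 * ?h x" by simp
qed

lemma superharmonic_at_add:
  assumes "0 < s" and m: "\<forall>x. m \<le> w x" and "superharmonic_at s w x"
  shows "superharmonic_at s (\<lambda>y. w y + c) x"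
proof -
  have m': "\<forall>y. m + c \<le> w y + c" using m by simp
  have "lo s (\<lambda>y. w y + c) x - c \<le> lo s w x"
    by (rule lo_greatest[OF assms(1)])
       (use lo_le[OF m'] in \<open>fastforce simp: algebra_simps\<close>)
  then show ?thesis using assms(3) unfolding superharmonic_at_def by (smt (verit))
qed

text \<open>A move changes the number of steps to \<open>a\<close> by at most one and some move
  lowers it by one, so off the apex gain and loss balance. With \<open>dist\<close> for
  \<open>s * steps\<close> this could fail within \<open>s\<close> of the apex, where less than
  \<open>s\<close> is left to descend.\<close>

lemma superharmonic_at_cone:
  fixes a :: "'a::metric_space"
  assumes len: "length_space TYPE('a)" and s: "0 < s" and "x \<noteq> a" and k: "0 \<le> k"
  shows "superharmonic_at s (\<lambda>y. c + k * (s * real (steps s y a))) x"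
    (is "superharmonic_at s ?g x")
  unfolding superharmonic_at_def
proof (intro allI impI)
  have ks: "0 \<le> k * s" using k s by simp
  have m: "\<forall>y. c \<le> ?g y" using k s by simp
  fix p assume p: "dist x p < s"
  obtain q where q: "dist x q < s" "Suc (steps s q a) \<le> steps s x a"
    using steps_descend[OF len s \<open>x \<noteq> a\<close>] .
  have "lo s ?g x \<le> ?g q" by (rule lo_le[OF m q(1)])
  also have "?g q \<le> ?g x - k * s"
    using mult_left_mono[OF of_nat_mono[OF q(2), where 'a=real] ks] by (simp add: algebra_simps)
  finally have 1: "lo s ?g x \<le> ?g x - k * s" .
  have "steps s p a \<le> Suc (steps s x a)" using steps_triangle_1[OF s, of p x a] p by (simp add: dist_commute)
  from mult_left_mono[OF of_nat_mono[OF this, where 'a=real] ks]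
  have "?g p \<le> ?g x + k * s" by (simp add: algebra_simps)
  with 1 show "?g p + lo s ?g x \<le> 2 * ?g x" by argo
qed

lemma cone_below:
  fixes W :: "'a::metric_space \<Rightarrow> real"
  assumes len: "length_space TYPE('a)" and s: "0 < s" and k: "0 < k" and m: "\<forall>x. m \<le> W x"
    and b: "b \<in> A" and sh: "\<And>x. x \<notin> A \<Longrightarrow> superharmonic_at s W x"
    and bdry: "\<And>a z. a \<in> A \<Longrightarrow> z \<notin> A \<Longrightarrow> dist a z < s \<Longrightarrow> c - k * (s * real (steps s a b)) \<le> W a"
    and x: "x \<notin> A"
  shows "c - k * (s * real (steps s x b)) \<le> W x"
proof -
  define \<phi> where "\<phi> = (\<lambda>z. c - k * (s * real (steps s z b)))"
  have ks: "0 < k * s" using k s by simp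
  have \<phi>_step: "\<phi> z - k * s \<le> \<phi> z'" if "dist z z' < s" for z z'
  proof -
    have "steps s z' b \<le> Suc (steps s z b)" using steps_triangle_1[OF s, of z' z b] that by (simp add: dist_commute)
    from mult_left_mono[OF of_nat_mono[OF this, where 'a=real] less_imp_le[OF ks]]
    show ?thesis unfolding \<phi>_def by (simp add: algebra_simps)
  qed
  have steep: False
    if z: "z \<notin> A" "dist z p < s" "W z < \<phi> z" "W z + k * s < W p" for z p
  proof -
    \<comment> \<open>Superharmonicity turns an ascent by more than \<open>k * s\<close> into a descent by more than \<open>k * s\<close>,
      which stays below the cone and hence outside \<open>A\<close>, and can therefore be repeated for ever.\<close>
    have "\<exists>z' p. z' \<notin> A \<and> dist z' p < s \<and> W z' < \<phi> z' \<and> W z' + k * s < W p \<and> W z' \<le> W z - real n * (k * s)" for n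
    proof (induction n)
      case 0
      show ?case using z by auto
    next
      case (Suc n)
      then obtain z' p where *: "z' \<notin> A" "dist z' p < s" "W z' < \<phi> z'" "W z' + k * s < W p"
        "W z' \<le> W z - real n * (k * s)" by blast
      have "lo s W z' < W z' - k * s"
        using superharmonic_atD[OF sh[OF *(1)] *(2)] *(4) by linarith
      then obtain q where q: "dist z' q < s" "W q < W z' - k * s" using lo_less[OF s] by metis
      have "W q < \<phi> q" using \<phi>_step[OF q(1)] q(2) *(3) by linarith
      moreover have "q \<notin> A"
        using bdry[of q z'] *(1) q(1) \<open>W q < \<phi> q\<close> unfolding \<phi>_def by (auto simp: dist_commute)
      moreover have "W q \<le> W z - real (Suc n) * (k * s)" using q(2) *(5) by (simp add: algebra_simps)
      ultimately show ?case using q by (metis dist_commute less_diff_eq)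
    qed
    moreover obtain n where "W z - m < real n * (k * s)" using ks reals_Archimedean3 by metis
    ultimately obtain z' where "W z' < m" by (smt (verit))
    with m show False by (simp add: not_less[symmetric])
  qed
  \<comment> \<open>Towards \<open>b\<close> the cone rises by \<open>k * s\<close> per move. A
    failure at \<open>x\<close>, with the bound known one step nearer to \<open>b\<close>, would
    thus be an ascent of \<open>W\<close> by more than \<open>k * s\<close>, which
    \<open>steep\<close> excludes.\<close>
  have "\<phi> x \<le> W x" if "steps s x b \<le> j" "x \<notin> A" for j x
    using that
  proof (induction j arbitrary: x)
    case 0
    with b show ?case by auto
  next
    case (Suc j)
    have "x \<noteq> b" using Suc.prems(2) b by blast
    then obtain p where p: "dist x p < s" "Suc (steps s p b) \<le> steps s x b"
      using steps_descend[OF len s] by metis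
    have "\<phi> p \<le> W p"
    proof (cases "p \<in> A")
      case True
      then show ?thesis using bdry[of p x] p(1) Suc.prems(2) by (simp add: \<phi>_def dist_commute)
    next
      case False
      then show ?thesis using Suc.IH[of p] Suc.prems(1) p(2) by simp
    qed
    moreover have "\<phi> x + k * s \<le> \<phi> p"
      using mult_left_mono[OF of_nat_mono[OF p(2), where 'a=real] less_imp_le[OF ks]]
      unfolding \<phi>_def by (simp add: algebra_simps)
    ultimately show ?case using steep[OF Suc.prems(2) p(1)] by (meson add_le_less_mono le_less_trans less_le_trans not_le add_strict_right_mono)
  qed
  with x show ?thesis unfolding \<phi>_def by blast
qed

section \<open>Supersolutions of the boundary value problem and the least among them\<close>

locale tug =
  fixes Y :: "'a::metric_space set" and F :: "'a \<Rightarrow> real" and L m :: real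
  assumes len: "length_space TYPE('a)" and Y_ne: "Y \<noteq> {}" and L_pos: "0 < L"
    and F_lip: "L-lipschitz_on Y F" and F_ge: "y \<in> Y \<Longrightarrow> m \<le> F y"
begin

text \<open>One bound \<open>m\<close> serves all members: it gives their infimum a meaning, ends
  infinite descents, and makes \<open>W - m\<close> a nonnegative supermartingale candidate.\<close>

definition supersolutions :: "real \<Rightarrow> ('a \<Rightarrow> real) set" where
  "supersolutions s = {W. (\<forall>x. m \<le> W x) \<and> (\<forall>y\<in>Y. F y \<le> W y) \<and> (\<forall>x. x \<notin> Y \<longrightarrow> superharmonic_at s W x)}"

definition u :: "real \<Rightarrow> 'a \<Rightarrow> real" where
  "u s x = (INF W\<in>supersolutions s. W x)"

text \<open>The McShane extension of \<open>F\<close> with the distance rounded to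
  \<open>s * steps\<close>, written as an infimum over a set of functions to match
  \<open>superharmonic_at_INF\<close>.\<close>

definition upper_cone :: "real \<Rightarrow> 'a \<Rightarrow> real" where
  "upper_cone s x = (INF w\<in>(\<lambda>y x. F y + L * (s * real (steps s x y))) ` Y. w x)"

lemma upper_cone_le:
  assumes "0 < s" "y \<in> Y" shows "upper_cone s x \<le> F y + L * (s * real (steps s x y))"
  unfolding upper_cone_def image_image
proof (rule cINF_lower[OF _ assms(2)])
  have "m \<le> F y + L * (s * real (steps s x y))" if "y \<in> Y" for y
    using F_ge[OF that] L_pos assms(1) by (simp add: add_increasing2)
  then show "bdd_below ((\<lambda>y. F y + L * (s * real (steps s x y))) ` Y)"
    by (intro bdd_belowI[of _ m]) auto
qed

lemma F_le_cone:
  assumes "0 < s" "y \<in> Y" "y' \<in> Y" shows "F y \<le> F y' + L * (s * real (steps s y y'))"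
proof -
  have "F y - F y' \<le> L * dist y y'"
    using lipschitz_onD[OF F_lip assms(2,3)] by (simp add: dist_real_def)
  also have "\<dots> \<le> L * (s * real (steps s y y'))"
    using dist_le_steps[OF assms(1)] L_pos by simp
  finally show ?thesis by simp
qed

lemma upper_cone_eq:
  assumes "0 < s" "y \<in> Y" shows "upper_cone s y = F y"
proof (rule antisym)
  show "upper_cone s y \<le> F y" using upper_cone_le[OF assms, of y] by simp
  show "F y \<le> upper_cone s y" unfolding upper_cone_def image_image
    using F_le_cone[OF assms] Y_ne by (intro cINF_greatest) auto
qed

lemma upper_cone_supersolution:
  assumes s: "0 < s" shows "upper_cone s \<in> supersolutions s"
proof -
  let ?C = "(\<lambda>y x. F y + L * (s * real (steps s x y))) ` Y"
  have m: "\<forall>w\<in>?C. \<forall>x. m \<le> w x"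
    using F_ge L_pos s by (auto simp: add_increasing2)
  have "superharmonic_at s (upper_cone s) x" if "x \<notin> Y" for x
    unfolding upper_cone_def
  proof (rule superharmonic_at_INF[OF s _ m])
    fix w assume "w \<in> ?C"
    then obtain y where y: "y \<in> Y" "w = (\<lambda>x. F y + L * (s * real (steps s x y)))" by blast
    with that have "x \<noteq> y" by blast
    then show "superharmonic_at s w x"
      unfolding y(2) using L_pos by (intro superharmonic_at_cone[OF len s]) simp_all
  qed (use Y_ne in auto)
  moreover have "m \<le> upper_cone s x" for x
    unfolding upper_cone_def using Y_ne m by (intro cINF_greatest) auto
  ultimately show ?thesis unfolding supersolutions_def using upper_cone_eq[OF s] by simp
qed

lemma supersolutionsD:
  assumes "W \<in> supersolutions s"
  shows "\<forall>x. m \<le> W x" "y \<in> Y \<Longrightarrow> F y \<le> W y" "x \<notin> Y \<Longrightarrow> superharmonic_at s W x"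
  using assms unfolding supersolutions_def by auto

lemma u_le: "W \<in> supersolutions s \<Longrightarrow> u s x \<le> W x"
  unfolding u_def by (rule cINF_lower) (auto simp: supersolutions_def intro!: bdd_belowI[of _ m])

lemma u_supersolution:
  assumes s: "0 < s" shows "u s \<in> supersolutions s"
proof -
  have ne: "supersolutions s \<noteq> {}" using upper_cone_supersolution[OF s] by blast
  have "superharmonic_at s (\<lambda>x. INF W\<in>supersolutions s. W x) x" if "x \<notin> Y" for x
    by (rule superharmonic_at_INF[OF s ne]) (use supersolutionsD that in auto)
  moreover have "m \<le> (INF W\<in>supersolutions s. W x)" for x
    using ne supersolutionsD(1) by (intro cINF_greatest) auto
  moreover have "F y \<le> (INF W\<in>supersolutions s. W y)" if "y \<in> Y" for y
    using ne supersolutionsD(2) that by (intro cINF_greatest) auto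
  ultimately show ?thesis unfolding supersolutions_def[of s] u_def[abs_def] by simp
qed

lemmas u_ge = supersolutionsD(1)[OF u_supersolution]
lemmas u_superharmonic = supersolutionsD(3)[OF u_supersolution]

lemma u_eq_F: "0 < s \<Longrightarrow> y \<in> Y \<Longrightarrow> u s y = F y"
  using u_le[OF upper_cone_supersolution, of s y] upper_cone_eq[of s y]
    supersolutionsD(2)[OF u_supersolution, of s y] by simp

lemma u_le_F_cone: "0 < s \<Longrightarrow> y \<in> Y \<Longrightarrow> u s x \<le> F y + L * (s * real (steps s x y))"
  using u_le[OF upper_cone_supersolution, of s x] upper_cone_le[of s y x] by simp

text \<open>Regularity comes from \<open>cone_below\<close> with apex \<open>z\<close> added to
  \<open>Y\<close>; on \<open>Y\<close> the required bound is the estimate of \<open>u s z\<close>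
  by the cone with apex there.\<close>

lemma u_lipschitz_steps:
  assumes s: "0 < s" shows "u s z - L * (s * real (steps s x z)) \<le> u s x"
proof -
  have on_Y: "u s z - L * (s * real (steps s a z)) \<le> u s a" if "a \<in> Y" for a
    using u_le_F_cone[OF s that, of z] u_eq_F[OF s that] by (simp add: steps_commute)
  show ?thesis
  proof (cases "x \<in> Y \<union> {z}")
    case True
    then show ?thesis using on_Y by auto
  next
    case False
    show ?thesis
      by (rule cone_below[OF len s L_pos u_ge[OF s], where A="Y \<union> {z}"])
         (use on_Y u_superharmonic[OF s] False in auto)
  qed
qed

lemma u_lipschitz:
  assumes s: "0 < s" shows "\<bar>u s x - u s z\<bar> \<le> L * (dist x z + s)"
proof -
  have "L * (s * real (steps s x z)) \<le> L * (dist x z + s)"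
    using steps_le_dist[OF s] L_pos by simp
  then show ?thesis
    using u_lipschitz_steps[OF s, of x z] u_lipschitz_steps[OF s, of z x] by (simp add: steps_commute)
qed

text \<open>
  Where \<open>W\<close> descends by at most \<open>\<delta>\<close>, it is replaced by the cheapest way to leave that flat region
  at a cost of \<open>\<delta>\<close> per move. The cost is \<open>O(\<delta>)\<close> at any given point, and the result descends by at
  least \<open>\<delta>\<close> everywhere, so that following it makes the game end.
\<close>

lemma strict_supersolution:
  assumes s: "0 < s" and W: "W \<in> supersolutions s" and \<eta>: "0 < \<eta>"
  obtains W' \<delta> where "W' \<in> supersolutions s" "0 < \<delta>" "W' x0 \<le> W x0 + \<eta>" "\<And>x. W x \<le> W' x"
    "\<And>x. x \<notin> Y \<Longrightarrow> lo s W' x \<le> W' x - \<delta>"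
proof -
  note m = supersolutionsD(1)[OF W] and sh = supersolutionsD(3)[OF W]
  obtain y0 where y0: "y0 \<in> Y" using Y_ne by blast
  \<comment> \<open>On the way from \<open>x0\<close> to \<open>y0\<close> each move costs \<delta>
    and \<open>W\<close> may rise by another \<delta>, hence the factor 2; adding 1 keeps the
    denominator positive.\<close>
  define \<delta> where "\<delta> = \<eta> / (2 * real (steps s x0 y0) + 1)"
  have \<delta>: "0 < \<delta>" using \<eta> by (simp add: \<delta>_def add_nonneg_pos)
  define A where "A = {x. lo s W x < W x - \<delta>} \<union> Y"
  \<comment> \<open>Chains are recorded from their point \<open>f 0\<close> in \<open>A\<close>,
    where \<open>W\<close> is kept, outwards to \<open>x\<close>; all later points lie in the flat
    region. The cost \<open>c\<close> is \<open>W (f 0)\<close> plus \<delta> per move.\<close>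
  define Q where "Q = (\<lambda>x c. \<exists>n. \<exists>f. f 0 \<in> A \<and> f n = x \<and> (\<forall>i<n. dist (f i) (f (Suc i)) < s \<and> f (Suc i) \<notin> A)
      \<and> c = W (f (0::nat)) + real n * \<delta>)"
  have Q0: "Q z (W z)" if "z \<in> A" for z
    unfolding Q_def by (rule exI[of _ 0], rule exI[of _ "\<lambda>_. z"]) (use that in simp)
  have Q1: "Q x (c + \<delta>)" if q: "Q p c" and "dist p x < s" "x \<notin> A" for p c x
  proof -
    obtain n f where f: "f 0 \<in> A" "f n = p" "\<forall>i<n. dist (f i) (f (Suc i)) < s \<and> f (Suc i) \<notin> A"
      "c = W (f (0::nat)) + real n * \<delta>" using q unfolding Q_def by blast
    show ?thesis unfolding Q_def
      by (rule exI[of _ "Suc n"], rule exI[of _ "f(Suc n := x)"])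
         (use f that in \<open>auto simp: less_Suc_eq algebra_simps\<close>)
  qed
  have Q_A: "c = W x" if q: "Q x c" and xA: "x \<in> A" for x c
  proof -
    obtain n f where f: "f n = x" "\<forall>i<n. f (Suc i) \<notin> A" "c = W (f (0::nat)) + real n * \<delta>"
      using q unfolding Q_def by blast
    then have "n = 0" using xA by (cases n) auto
    with f show ?thesis by simp
  qed
  have Q_not_A: "\<exists>p c'. Q p c' \<and> dist p x < s \<and> c = c' + \<delta>" if q: "Q x c" and xA: "x \<notin> A" for x c
  proof -
    obtain n f where f: "f 0 \<in> A" "f n = x" "\<forall>i<n. dist (f i) (f (Suc i)) < s \<and> f (Suc i) \<notin> A"
      "c = W (f (0::nat)) + real n * \<delta>" using q unfolding Q_def by blast
    then obtain k where k: "n = Suc k" using xA by (cases n) auto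
    have "Q (f k) (W (f 0) + real k * \<delta>)" unfolding Q_def using f k by (intro exI[of _ k] exI[of _ f]) auto
    moreover have "dist (f k) x < s" using f k by auto
    ultimately show ?thesis using f(4) k
      by (intro exI[of _ "f k"] exI[of _ "W (f 0) + real k * \<delta>"]) (simp add: algebra_simps)
  qed
  have flat: "W x - \<delta> \<le> W p" "W p \<le> W x + \<delta>" if "x \<notin> A" "dist x p < s" for x p
  proof -
    have x: "W x - \<delta> \<le> lo s W x" "x \<notin> Y" using that(1) unfolding A_def by auto
    then show "W x - \<delta> \<le> W p" using lo_le[OF m that(2)] by linarith
    show "W p \<le> W x + \<delta>" using superharmonic_atD[OF sh[OF x(2)] that(2)] x(1) by linarith
  qed
  have Q_ge: "W x \<le> c" if q: "Q x c" for x c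
  proof -
    obtain n f where f: "f n = x" "\<forall>i<n. dist (f i) (f (Suc i)) < s \<and> f (Suc i) \<notin> A"
      "c = W (f (0::nat)) + real n * \<delta>" using q unfolding Q_def by blast
    have "j \<le> n \<longrightarrow> W (f j) \<le> W (f 0) + real j * \<delta>" for j
    proof (induction j)
      case (Suc j)
      show ?case
      proof
        assume "Suc j \<le> n"
        then show "W (f (Suc j)) \<le> W (f 0) + real (Suc j) * \<delta>"
          using Suc flat(1)[of "f (Suc j)" "f j"] f(2) by (auto simp: dist_commute algebra_simps)
      qed
    qed simp
    then show ?thesis using f by auto
  qed
  have Q_ex: "\<exists>c. Q x c \<and> c \<le> W x + 2 * real k * \<delta>" if "steps s x y0 \<le> k" for x k
    using that
  proof (induction k arbitrary: x)
    case 0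
    then have "x \<in> A" using y0 unfolding A_def by simp
    then show ?case using Q0 by auto
  next
    case (Suc k)
    show ?case
    proof (cases "x \<in> A")
      case True
      then show ?thesis using Q0 \<delta> by (intro exI[of _ "W x"]) auto
    next
      case False
      then have "x \<noteq> y0" using y0 unfolding A_def by blast
      then obtain p where p: "dist x p < s" "Suc (steps s p y0) \<le> steps s x y0"
        using steps_descend[OF len s] by metis
      then have "steps s p y0 \<le> k" using Suc.prems by simp
      then obtain c where c: "Q p c" "c \<le> W p + 2 * real k * \<delta>" using Suc.IH by blast
      have "Q x (c + \<delta>)" using Q1[OF c(1)] p(1) False by (simp add: dist_commute)
      moreover have "c + \<delta> \<le> W x + 2 * real (Suc k) * \<delta>"
        using c(2) flat(2)[OF False p(1)] by (simp add: algebra_simps)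
      ultimately show ?thesis by blast
    qed
  qed
  define W' where "W' = (\<lambda>x. Inf {c. Q x c})"
  have ne: "{c. Q x c} \<noteq> {}" for x using Q_ex[of x "steps s x y0"] by auto
  have bd: "bdd_below {c. Q x c}" for x using Q_ge by (intro bdd_belowI[of _ "W x"]) auto
  have W'_le: "W' x \<le> c" if "Q x c" for x c unfolding W'_def using cInf_lower[OF _ bd] that by auto
  have W'_geI: "a \<le> W' x" if "\<And>c. Q x c \<Longrightarrow> a \<le> c" for x a
    unfolding W'_def using ne that by (intro cInf_greatest) auto
  have W_le: "W x \<le> W' x" for x by (rule W'_geI) (rule Q_ge)
  have W'_A: "W' x = W x" if "x \<in> A" for x using W'_le[OF Q0[OF that]] W_le[of x] by simp
  have m': "\<forall>x. m \<le> W' x" using W_le m order_trans by blast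
  \<comment> \<open>A point where \<open>W\<close> is more than \<delta> below \<open>W x\<close>
    must lie in \<open>A\<close>: elsewhere the move to \<open>x\<close> would ascend by more than
    flatness allows. Such points keep their value under the modification.\<close>
  have lo_A: "lo s W' x \<le> lo s W x" if "x \<in> A" "x \<notin> Y" for x
  proof (rule ccontr)
    assume "\<not> lo s W' x \<le> lo s W x"
    then have "lo s W x < min (lo s W' x) (W x - \<delta>)" using that unfolding A_def by simp
    then obtain y where y: "dist x y < s" "W y < min (lo s W' x) (W x - \<delta>)" using lo_less[OF s] by metis
    have "y \<in> A"
    proof (rule ccontr)
      assume "y \<notin> A"
      from flat(2)[OF this, of x] y show False by (simp add: dist_commute)
    qed
    then show False using lo_le[OF m' y(1)] y(2) W'_A by simp
  qed
  have down: "lo s W' x \<le> W' x - \<delta>" if "x \<notin> Y" for x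
  proof (cases "x \<in> A")
    case True
    then have "lo s W x < W x - \<delta>" using that unfolding A_def by blast
    with lo_A[OF True that] W_le[of x] show ?thesis by linarith
  next
    case False
    have "lo s W' x + \<delta> \<le> W' x"
    proof (rule W'_geI)
      fix c assume "Q x c"
      then obtain p c' where p: "Q p c'" "dist p x < s" "c = c' + \<delta>" using Q_not_A False by blast
      show "lo s W' x + \<delta> \<le> c" using lo_le[OF m', of x p s] W'_le[OF p(1)] p by (simp add: dist_commute)
    qed
    then show ?thesis by simp
  qed
  have "superharmonic_at s W' x" if xY: "x \<notin> Y" for x
    unfolding superharmonic_at_def
  proof (intro allI impI)
    fix p assume p: "dist x p < s"
    show "W' p + lo s W' x \<le> 2 * W' x"
    proof (cases "x \<in> A")
      case False
      have "W' p \<le> W' x + \<delta>"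
      proof (cases "p \<in> A")
        case True
        then show ?thesis using W'_A[OF True] flat(2)[OF False p] W_le[of x] by linarith
      next
        case pA: False
        have "W' p - \<delta> \<le> W' x"
          by (rule W'_geI) (use W'_le Q1 pA p in fastforce)
        then show ?thesis by simp
      qed
      then show ?thesis using down[OF xY] by simp
    next
      case True
      have d: "lo s W x < W x - \<delta>" using True xY unfolding A_def by blast
      show ?thesis
      proof (cases "p \<in> A")
        case True
        then show ?thesis using superharmonic_atD[OF sh[OF xY] p] lo_A[OF \<open>x \<in> A\<close> xY] W'_A[OF True] W'_A[OF \<open>x \<in> A\<close>] by linarith
      next
        case False
        have "W' p \<le> W x + \<delta>" using W'_le[OF Q1[OF Q0[OF \<open>x \<in> A\<close>] p False]] .
        then show ?thesis using d lo_A[OF \<open>x \<in> A\<close> xY] W'_A[OF \<open>x \<in> A\<close>] by linarith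
      qed
    qed
  qed
  moreover have "F y \<le> W' y" if "y \<in> Y" for y
    using supersolutionsD(2)[OF W that] W_le[of y] by linarith
  ultimately have "W' \<in> supersolutions s" unfolding supersolutions_def using m' by blast
  moreover have "W' x0 \<le> W x0 + \<eta>"
  proof -
    obtain c where "Q x0 c" "c \<le> W x0 + 2 * real (steps s x0 y0) * \<delta>" using Q_ex by blast
    moreover have "2 * real (steps s x0 y0) * \<delta> \<le> \<eta>"
      using \<eta> unfolding \<delta>_def by (simp add: field_simps)
    ultimately show ?thesis using W'_le[of x0 c] by linarith
  qed
  ultimately show thesis using that[of W' \<delta>] \<delta> W_le down by blast
qed

end

section \<open>The law of the final position\<close>

text \<open>Monotone convergence along chains makes upper bounds on integrals admissible for
  induction over the least fixed point \<open>final_position\<close>. Positive lower bounds are not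
  inductive, since the induction starts from zero mass.\<close>

lemma nn_integral_lub_spmf_le:
  fixes g :: "'b \<Rightarrow> ennreal"
  assumes chain: "Complete_Partial_Order.chain (ord_spmf (=)) C" and C: "C \<noteq> {}"
    and le: "\<And>p. p \<in> C \<Longrightarrow> (\<integral>\<^sup>+x. g x \<partial>measure_spmf p) \<le> c"
  shows "(\<integral>\<^sup>+x. g x \<partial>measure_spmf (lub_spmf C)) \<le> c"
proof -
  let ?M = "count_space (set_spmf (lub_spmf C))"
  have "(\<integral>\<^sup>+x. g x \<partial>measure_spmf (lub_spmf C)) = \<integral>\<^sup>+ x. ennreal (spmf (lub_spmf C) x) * g x \<partial>?M"
    by (simp add: nn_integral_measure_spmf')
  also have "\<dots> = \<integral>\<^sup>+ x. (SUP p\<in>C. ennreal (spmf p x) * g x) \<partial>?M"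
    by (simp add: ennreal_spmf_lub_spmf[OF chain C] SUP_mult_right_ennreal C)
  also have "\<dots> = (SUP p\<in>C. \<integral>\<^sup>+ x. ennreal (spmf p x) * g x \<partial>?M)"
  proof (rule nn_integral_monotone_convergence_SUP_countable[OF C])
    have "(\<lambda>p x. ennreal (spmf p x) * g x) ` C = (\<lambda>f x. f x * g x) ` (\<lambda>p x. ennreal (spmf p x)) ` C"
      by (simp add: image_image)
    also have "Complete_Partial_Order.chain (\<le>) \<dots>" using chain_ord_spmf_eqD[OF chain]
      by (rule chain_imageI) (auto simp: le_fun_def intro: mult_right_mono)
    finally show "Complete_Partial_Order.chain (\<le>) ((\<lambda>p x. ennreal (spmf p x) * g x) ` C)" .
  qed simp
  also have "\<dots> \<le> c"
  proof (rule SUP_least)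
    fix p assume p: "p \<in> C"
    have "(\<integral>\<^sup>+ x. ennreal (spmf p x) * g x \<partial>?M) \<le> (\<integral>\<^sup>+ x. ennreal (spmf p x) * g x \<partial>count_space UNIV)"
      by (auto simp: nn_integral_count_space_indicator intro!: nn_integral_mono split: split_indicator)
    also have "\<dots> \<le> c" using le[OF p] by (simp add: nn_integral_measure_spmf)
    finally show "(\<integral>\<^sup>+ x. ennreal (spmf p x) * g x \<partial>?M) \<le> c" .
  qed
  finally show ?thesis .
qed

lemma nn_integral_bind_spmf:
  "(\<integral>\<^sup>+x. g x \<partial>measure_spmf (bind_spmf p f)) = (\<integral>\<^sup>+y. (\<integral>\<^sup>+x. g x \<partial>measure_spmf (f y)) \<partial>measure_spmf p)"
  unfolding measure_spmf_bind o_def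
  by (subst nn_integral_bind[where B="count_space UNIV"]) (auto intro: measurable_measure_spmf)

lemma nn_integral_play_turn:
  fixes f :: "bool \<Rightarrow> 'a \<Rightarrow> 'a spmf"
  shows "(\<integral>\<^sup>+x. g x \<partial>measure_spmf (bind_spmf coin_spmf (\<lambda>b. bind_spmf (spmf_of_pmf (if b then S else T)) (f b)))) =
    ((\<integral>\<^sup>+x. (\<integral>\<^sup>+y. g y \<partial>measure_spmf (f True x)) \<partial>measure_pmf S) +
     (\<integral>\<^sup>+x. (\<integral>\<^sup>+y. g y \<partial>measure_spmf (f False x)) \<partial>measure_pmf T)) / 2"
  by (simp add: nn_integral_bind_spmf nn_integral_spmf_of_set UNIV_bool add.commute del: bind_spmf_of_pmf)

lemma nn_integral_measure_pmf_le:
  assumes "\<And>x. x \<in> set_pmf p \<Longrightarrow> f x \<le> c" shows "(\<integral>\<^sup>+x. f x \<partial>measure_pmf p) \<le> c"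
proof -
  have "(\<integral>\<^sup>+x. f x \<partial>measure_pmf p) \<le> (\<integral>\<^sup>+x. c \<partial>measure_pmf p)"
    by (rule nn_integral_mono_AE) (use assms in \<open>simp add: AE_measure_pmf_iff\<close>)
  then show ?thesis by simp
qed

lemma nn_integral_measure_pmf_ge:
  assumes "\<And>x. x \<in> set_pmf p \<Longrightarrow> c \<le> f x" shows "c \<le> (\<integral>\<^sup>+x. f x \<partial>measure_pmf p)"
proof -
  have "(\<integral>\<^sup>+x. c \<partial>measure_pmf p) \<le> (\<integral>\<^sup>+x. f x \<partial>measure_pmf p)"
    by (rule nn_integral_mono_AE) (use assms in \<open>simp add: AE_measure_pmf_iff\<close>)
  then show ?thesis by simp
qed

lemma final_position_stop: "position h \<in> Y \<Longrightarrow> final_position Y S T h = return_spmf (position h)"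
  by (subst final_position.simps) simp

lemma nn_integral_final_position:
  assumes "position h \<notin> Y"
  shows "(\<integral>\<^sup>+x. g x \<partial>measure_spmf (final_position Y S T h)) =
    ((\<integral>\<^sup>+x. (\<integral>\<^sup>+y. g y \<partial>measure_spmf (final_position Y S T (extend_game h True x))) \<partial>measure_pmf (S h)) +
     (\<integral>\<^sup>+x. (\<integral>\<^sup>+y. g y \<partial>measure_spmf (final_position Y S T (extend_game h False x))) \<partial>measure_pmf (T h))) / 2"
  by (subst final_position.simps) (simp only: assms if_False nn_integral_play_turn)

lemma final_position_induct:
  assumes step: "\<And>f. (\<And>h. P h (f h)) \<Longrightarrow>
      (\<And>h. P h (if position h \<in> Y then return_spmf (position h)
      else bind_spmf coin_spmf (\<lambda>b. bind_spmf (spmf_of_pmf (if b then S h else T h)) (\<lambda>x. f (extend_game h b x)))))"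
    and bot: "\<And>h. P h (return_pmf None)"
    and adm: "\<And>h C. Complete_Partial_Order.chain (ord_spmf (=)) C \<Longrightarrow> C \<noteq> {} \<Longrightarrow> (\<And>p. p \<in> C \<Longrightarrow> P h p) \<Longrightarrow> P h (lub_spmf C)"
  shows "P h (final_position Y S T h)"
proof -
  have "\<forall>h. P h (final_position Y S T h)"
  proof (rule final_position.fixp_induct[where P="\<lambda>f. \<forall>h. P h (f Y S T h)"])
    show "spmf.admissible (\<lambda>f. \<forall>h. P h (curry (curry (curry f)) Y S T h))"
      unfolding ccpo.admissible_def
    proof (intro allI impI)
      fix A h assume A: "Complete_Partial_Order.chain spmf.le_fun A" "A \<noteq> {}"
        "\<forall>f\<in>A. \<forall>h. P h (curry (curry (curry f)) Y S T h)"
      have "Complete_Partial_Order.chain (ord_spmf (=)) {q. \<exists>f\<in>A. q = f (((Y, S), T), h)}"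
        by (rule chain_fun[OF A(1)])
      moreover have "{q. \<exists>f\<in>A. q = f (((Y, S), T), h)} \<noteq> {}" using A(2) by blast
      moreover have "P h q" if "q \<in> {q. \<exists>f\<in>A. q = f (((Y, S), T), h)}" for q
        using A(3) that unfolding curry_def by blast
      ultimately show "P h (curry (curry (curry (spmf.lub_fun A))) Y S T h)"
        unfolding curry_def fun_lub_def by (rule adm)
    qed
  next
    show "\<forall>h. P h (return_pmf None)" using bot by blast
  next
    fix f assume "\<forall>h. P h (f Y S T h)"
    then show "\<forall>h. P h (if position h \<in> Y then return_spmf (position h)
      else bind_spmf coin_spmf (\<lambda>b. bind_spmf (spmf_of_pmf (if b then S h else T h))
        (\<lambda>x. f Y S T (extend_game h b x))))"
      using step[of "f Y S T"] by blast
  qed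
  then show ?thesis by blast
qed

lemma set_final_position: "set_spmf (final_position Y S T h) \<subseteq> Y"
proof (rule final_position_induct[where P="\<lambda>h p. set_spmf p \<subseteq> Y"])
  fix f :: "'a partial_game \<Rightarrow> 'a spmf" and h assume f: "\<And>h. set_spmf (f h) \<subseteq> Y"
  have "set_spmf (bind_spmf coin_spmf (\<lambda>b. bind_spmf (spmf_of_pmf (if b then S h else T h))
      (\<lambda>x. f (extend_game h b x)))) \<subseteq> Y"
    unfolding set_bind_spmf bind_UNION o_def using f by blast
  then show "set_spmf (if position h \<in> Y then return_spmf (position h)
      else bind_spmf coin_spmf (\<lambda>b. bind_spmf (spmf_of_pmf (if b then S h else T h))
        (\<lambda>x. f (extend_game h b x)))) \<subseteq> Y"
    by simp
next
  fix C assume "Complete_Partial_Order.chain (ord_spmf (=)) C" "C \<noteq> {}" "\<And>p. p \<in> C \<Longrightarrow> set_spmf p \<subseteq> Y"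
  then show "set_spmf (lub_spmf C) \<subseteq> Y" by (auto simp: set_lub_spmf)
qed simp

text \<open>Optional stopping for a nonnegative supermartingale \<open>\<Phi>\<close>. Plays that
  never end contribute nothing to the left side, so the bound holds whether or not the game
  ends.\<close>

lemma nn_integral_final_position_le:
  fixes \<Phi> :: "'a partial_game \<Rightarrow> ennreal"
  assumes stop: "\<And>h. position h \<in> Y \<Longrightarrow> g (position h) \<le> \<Phi> h"
    and step: "\<And>h. position h \<notin> Y \<Longrightarrow> ((\<integral>\<^sup>+x. \<Phi> (extend_game h True x) \<partial>measure_pmf (S h)) +
      (\<integral>\<^sup>+x. \<Phi> (extend_game h False x) \<partial>measure_pmf (T h))) / 2 \<le> \<Phi> h"
  shows "(\<integral>\<^sup>+x. g x \<partial>measure_spmf (final_position Y S T h)) \<le> \<Phi> h"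
proof (rule final_position_induct[where P="\<lambda>h p. (\<integral>\<^sup>+x. g x \<partial>measure_spmf p) \<le> \<Phi> h"])
  fix f h assume f: "\<And>h. (\<integral>\<^sup>+x. g x \<partial>measure_spmf (f h)) \<le> \<Phi> h"
  show "(\<integral>\<^sup>+x. g x \<partial>measure_spmf (if position h \<in> Y then return_spmf (position h)
      else bind_spmf coin_spmf (\<lambda>b. bind_spmf (spmf_of_pmf (if b then S h else T h)) (\<lambda>x. f (extend_game h b x))))) \<le> \<Phi> h"
  proof (cases "position h \<in> Y")
    case True
    then show ?thesis using stop[OF True] by (simp add: measure_spmf_return_spmf nn_integral_return)
  next
    case False
    have "((\<integral>\<^sup>+x. (\<integral>\<^sup>+y. g y \<partial>measure_spmf (f (extend_game h True x))) \<partial>measure_pmf (S h)) +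
     (\<integral>\<^sup>+x. (\<integral>\<^sup>+y. g y \<partial>measure_spmf (f (extend_game h False x))) \<partial>measure_pmf (T h))) / 2 \<le>
      ((\<integral>\<^sup>+x. \<Phi> (extend_game h True x) \<partial>measure_pmf (S h)) +
      (\<integral>\<^sup>+x. \<Phi> (extend_game h False x) \<partial>measure_pmf (T h))) / 2"
      by (intro divide_right_mono_ennreal add_mono nn_integral_mono f)
    also have "\<dots> \<le> \<Phi> h" by (rule step[OF False])
    finally show ?thesis using False by (simp only: if_False nn_integral_play_turn)
  qed
next
  fix h show "(\<integral>\<^sup>+x. g x \<partial>measure_spmf (return_pmf None)) \<le> \<Phi> h" by simp
qed (rule nn_integral_lub_spmf_le)

lemma weight_spmf_eq_nn_integral: "ennreal (weight_spmf p) = (\<integral>\<^sup>+x. 1 \<partial>measure_spmf p)"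
  by (simp add: measure_spmf.emeasure_eq_measure)

lemma weight_final_position_ge:
  assumes "position h \<notin> Y"
    and a: "\<And>x. x \<in> set_pmf (S h) \<Longrightarrow> a \<le> weight_spmf (final_position Y S T (extend_game h True x))"
    and b: "\<And>x. x \<in> set_pmf (T h) \<Longrightarrow> b \<le> weight_spmf (final_position Y S T (extend_game h False x))"
  shows "(a + b) / 2 \<le> weight_spmf (final_position Y S T h)"
proof -
  have "ennreal ((a + b) / 2) = ennreal (a + b) / 2" 
    by (cases "0 \<le> a + b") (auto simp: ennreal_divide_numeral ennreal_neg)
  \<comment> \<open>\<open>a\<close> or \<open>b\<close> may be negative; \<open>ennreal\<close>
    cuts them off at 0, which can only enlarge the right side.\<close>
  also have "\<dots> \<le> (ennreal a + ennreal b) / 2"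
    by (intro divide_right_mono_ennreal) (smt (verit) ennreal_leI ennreal_neg ennreal_plus add_0 add_0_right zero_le)
  also have "\<dots> \<le> ennreal (weight_spmf (final_position Y S T h))"
    unfolding weight_spmf_eq_nn_integral nn_integral_final_position[OF assms(1)]
    using a b by (intro divide_right_mono_ennreal add_mono nn_integral_measure_pmf_ge)
      (simp_all add: weight_spmf_eq_nn_integral[symmetric] ennreal_leI del: nn_integral_const)
  finally show ?thesis by (simp add: ennreal_le_iff)
qed

text \<open>The product of the two arguments is \<open>(1 + t)\<^sup>2\<close> times
  \<open>1 - d\<^sup>2 / (1 + t)\<^sup>2\<close>, and \<open>ln\<close> lies below its tangent at
  1.\<close>

lemma ln_concave_gap:
  fixes t d :: real
  assumes "0 \<le> d" "d \<le> t"
  shows "ln (1 + (t + d)) + ln (1 + (t - d)) \<le> 2 * ln (1 + t) - d\<^sup>2 / (1 + t)\<^sup>2"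
proof -
  have pos: "0 < 1 + t" "0 < 1 + (t + d)" "0 < 1 + (t - d)" using assms by auto
  have "(1 + (t + d)) * (1 + (t - d)) = (1 + t)\<^sup>2 * (1 - d\<^sup>2 / (1 + t)\<^sup>2)"
  proof -
    have "(1 + t)\<^sup>2 * (1 - d\<^sup>2 / (1 + t)\<^sup>2) = (1 + t)\<^sup>2 - d\<^sup>2" using pos(1) by (simp add: right_diff_distrib)
    then show ?thesis by (simp add: power2_eq_square algebra_simps)
  qed
  moreover have "0 < 1 - d\<^sup>2 / (1 + t)\<^sup>2"
    using assms by (simp add: power_strict_mono)
  ultimately have "ln (1 + (t + d)) + ln (1 + (t - d)) = 2 * ln (1 + t) + ln (1 - d\<^sup>2 / (1 + t)\<^sup>2)"
    using pos by (simp flip: ln_mult_pos add: ln_mult_pos ln_realpow)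
  also have "ln (1 - d\<^sup>2 / (1 + t)\<^sup>2) \<le> - (d\<^sup>2 / (1 + t)\<^sup>2)"
    using ln_le_minus_one[OF \<open>0 < 1 - d\<^sup>2 / (1 + t)\<^sup>2\<close>] by simp
  finally show ?thesis by simp
qed

text \<open>
  A nonnegative supermartingale whose decreases are bounded away from \<open>0\<close> ends almost surely: since \<open>ln\<close> is
  strictly concave, \<open>ln (1 + \<Phi>)\<close> loses in expectation a fixed amount per turn while \<open>\<Phi> \<le> M\<close>, and
  \<open>\<Phi>\<close> exceeds \<open>M\<close> with probability at most \<open>\<Phi> / M\<close>.
\<close>

lemma lossless_final_position:
  fixes \<Phi> :: "'a partial_game \<Rightarrow> real"
  assumes nonneg: "\<And>h. 0 \<le> \<Phi> h" and c: "0 < c"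
    and step: "\<And>h. position h \<notin> Y \<Longrightarrow> \<exists>D\<ge>c.
      (\<forall>x\<in>set_pmf (if b then S h else T h). \<Phi> (extend_game h b x) \<le> \<Phi> h - D) \<and>
      (\<forall>x\<in>set_pmf (if b then T h else S h). \<Phi> (extend_game h (\<not> b) x) \<le> \<Phi> h + D)"
  shows "lossless_spmf (final_position Y S T h)"
proof -
  define w where "w = (\<lambda>h. weight_spmf (final_position Y S T h))"
  have w: "0 \<le> w h" "w h \<le> 1" for h by (simp_all add: w_def weight_spmf_le_1 weight_spmf_nonneg)
  have bound: "1 - w h \<le> \<Phi> h / M" if M: "0 < M" for M h
  proof -
    \<comment> \<open>The mean loss of \<open>ln (1 + t)\<close> in one turn is at least half of
      \<open>D\<^sup>2 / (1 + t)\<^sup>2\<close>, which is at least \<kappa> while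
      \<open>t \<le> M\<close>.\<close>
    define \<kappa> where "\<kappa> = c\<^sup>2 / (2 * (1 + M)\<^sup>2)"
    have \<kappa>: "0 < \<kappa>" using c M by (simp add: \<kappa>_def)
    \<comment> \<open>Bounds \<open>n\<close> times the probability of never ending: a turn with
      \<open>t > M\<close> is paid for by \<open>t / M\<close>, any other by the loss of
      \<open>ln (1 + t)\<close>. The second term does not depend on \<open>n\<close>, so for large
      \<open>n\<close> only \<open>t / M\<close> remains.\<close>
    define B where "B = (\<lambda>(n::nat) t. real n * t / M + ln (1 + t) / \<kappa>)"
    have B_mono: "B n t \<le> B n t'" if "0 \<le> t" "t \<le> t'" for n t t'
      unfolding B_def using that M \<kappa> by (intro add_mono divide_right_mono mult_left_mono) auto
    have B_pos: "0 \<le> B n t" if "0 \<le> t" for n t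
      unfolding B_def using that M \<kappa> by (intro add_nonneg_nonneg divide_nonneg_nonneg) auto
    have claim: "real n * (1 - w h) \<le> B n (\<Phi> h)" for n h
    proof (induction n arbitrary: h)
      case 0
      show ?case using B_pos[OF nonneg[of h]] by simp
    next
      case (Suc n)
      show ?case
      proof (cases "position h \<in> Y")
        case True
        then have "w h = 1" by (simp add: w_def final_position_stop)
        then show ?thesis using B_pos[OF nonneg] by simp
      next
        case False
        define t where "t = \<Phi> h"
        obtain D where D: "c \<le> D"
          "\<And>x. x \<in> set_pmf (if b then S h else T h) \<Longrightarrow> \<Phi> (extend_game h b x) \<le> t - D"
          "\<And>x. x \<in> set_pmf (if b then T h else S h) \<Longrightarrow> \<Phi> (extend_game h (\<not> b) x) \<le> t + D"
          using step[OF False] unfolding t_def by blast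
        have "set_pmf (if b then S h else T h) \<noteq> {}" by (rule set_pmf_not_empty)
        then obtain x0 where "x0 \<in> set_pmf (if b then S h else T h)" by blast
        then have tD: "D \<le> t" using D(2)[of x0] nonneg[of "extend_game h b x0"] by linarith
        have t: "0 \<le> t" unfolding t_def by (rule nonneg)
        have "real n * (1 - w h) \<le> (B n (t + D) + B n (t - D)) / 2"
        proof (cases "n = 0")
          case True
          then show ?thesis using B_pos[of "t + D" 0] B_pos[of "t - D" 0] tD t c D(1) by simp
        next
          case n: False
          have next_w: "1 - B n r / real n \<le> w h'" if "\<Phi> h' \<le> r" for h' r
          proof -
            have "real n * (1 - w h') \<le> B n r"
              using Suc.IH[of h'] B_mono[OF nonneg that, of n] by linarith
            then show ?thesis using n by (simp add: field_simps)
          qed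
          define bT where "bT = (if b then t - D else t + D)"
          define bF where "bF = (if b then t + D else t - D)"
          have "((1 - B n bT / real n) + (1 - B n bF / real n)) / 2 \<le> w h"
            unfolding w_def
          proof (rule weight_final_position_ge[OF False])
            fix x assume "x \<in> set_pmf (S h)"
            then have "\<Phi> (extend_game h True x) \<le> bT"
              using D(2)[of x] D(3)[of x] by (cases b) (auto simp: bT_def)
            from next_w[OF this]
            show "1 - B n bT / real n \<le> weight_spmf (final_position Y S T (extend_game h True x))"
              by (simp add: w_def)
          next
            fix x assume "x \<in> set_pmf (T h)"
            then have "\<Phi> (extend_game h False x) \<le> bF"
              using D(2)[of x] D(3)[of x] by (cases b) (auto simp: bF_def)
            from next_w[OF this]
            show "1 - B n bF / real n \<le> weight_spmf (final_position Y S T (extend_game h False x))"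
              by (simp add: w_def)
          qed
          then have "real n * (((1 - B n bT / real n) + (1 - B n bF / real n)) / 2) \<le> real n * w h"
            by (rule mult_left_mono) simp
          moreover have "real n * (((1 - B n bT / real n) + (1 - B n bF / real n)) / 2)
              = real n - (B n bT + B n bF) / 2"
            using n by (simp add: field_simps)
          ultimately have "real n - (B n bT + B n bF) / 2 \<le> real n * w h" by metis
          then have "real n * (1 - w h) \<le> (B n bT + B n bF) / 2"
            unfolding right_diff_distrib mult_1_right by linarith
          then show ?thesis unfolding bT_def bF_def by (cases b) (auto simp: add.commute)
        qed
        also have "\<dots> = real n * t / M + (ln (1 + (t + D)) + ln (1 + (t - D))) / (2 * \<kappa>)"
          unfolding B_def using M \<kappa> by (simp add: field_simps)
        also have "\<dots> \<le> real n * t / M + (2 * ln (1 + t) - D\<^sup>2 / (1 + t)\<^sup>2) / (2 * \<kappa>)"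
          using ln_concave_gap[of D t] D(1) c tD \<kappa> by (intro add_left_mono divide_right_mono) auto
        also have "\<dots> = B n t - D\<^sup>2 / (1 + t)\<^sup>2 / (2 * \<kappa>)"
          unfolding B_def using \<kappa> by (simp add: diff_divide_distrib)
        finally have 1: "real n * (1 - w h) \<le> B n t - D\<^sup>2 / (1 + t)\<^sup>2 / (2 * \<kappa>)" .
        have 2: "1 - w h \<le> t / M + D\<^sup>2 / (1 + t)\<^sup>2 / (2 * \<kappa>)"
        proof (cases "t \<le> M")
          case True
          have "c\<^sup>2 / (1 + M)\<^sup>2 \<le> D\<^sup>2 / (1 + t)\<^sup>2"
            using D(1) c True t by (intro frac_le power_mono) auto
          moreover have "2 * \<kappa> = c\<^sup>2 / (1 + M)\<^sup>2" by (simp add: \<kappa>_def)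
          ultimately have "2 * \<kappa> \<le> D\<^sup>2 / (1 + t)\<^sup>2" by (simp only:)
          moreover have "0 < 2 * \<kappa>" using \<kappa> by simp
          ultimately have "1 \<le> D\<^sup>2 / (1 + t)\<^sup>2 / (2 * \<kappa>)" by (simp only: le_divide_eq_1_pos)
          moreover have "0 \<le> t / M" using t M by simp
          ultimately show ?thesis using w(1)[of h] by linarith
        next
          case False
          then have "1 \<le> t / M" using M by simp
          moreover have "0 \<le> D\<^sup>2 / (1 + t)\<^sup>2 / (2 * \<kappa>)" using \<kappa> by simp
          ultimately show ?thesis using w(1)[of h] by linarith
        qed
        have "B (Suc n) t = B n t + t / M" unfolding B_def by (simp add: add_divide_distrib distrib_right)
        then show ?thesis using 1 2 unfolding t_def by (simp add: algebra_simps)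
      qed
    qed
    show ?thesis
    proof (rule ccontr)
      assume "\<not> 1 - w h \<le> \<Phi> h / M"
      then have "0 < 1 - w h - \<Phi> h / M" by simp
      then obtain n where "ln (1 + \<Phi> h) / \<kappa> < real n * (1 - w h - \<Phi> h / M)"
        using reals_Archimedean3 by blast
      then show False using claim[of n h] unfolding B_def by (simp add: algebra_simps)
    qed
  qed
  have "w h = 1"
  proof (rule ccontr)
    assume "w h \<noteq> 1"
    then have pos: "0 < 1 - w h" using w(2)[of h] by simp
    define M where "M = (\<Phi> h + 1) / (1 - w h)"
    have "0 < M" using pos nonneg[of h] unfolding M_def by simp
    from bound[OF this, of h] have "(1 - w h) * M \<le> \<Phi> h" using \<open>0 < M\<close> by (simp add: pos_le_divide_eq)
    then show False using pos unfolding M_def by simp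
  qed
  then show ?thesis unfolding lossless_spmf_def w_def .
qed

section \<open>The value of the game\<close>

lemma position_extend_game [simp]: "position (extend_game h b x) = x"
  by (simp add: position_def extend_game_def)

lemma strategiesD: "S \<in> strategies s \<Longrightarrow> x \<in> set_pmf (S h) \<Longrightarrow> dist (position h) x < s"
  unfolding strategies_def by (subst dist_commute) blast

lemma F_minus_le_F_plus: "F_minus Y F x S T \<le> F_plus Y F x S T"
  by (simp add: F_minus_def F_plus_def Let_def)

lemma value_I_le_value_II: "value_I Y F s (x :: 'a :: metric_space) \<le> value_II Y F s x"
  unfolding value_I_def value_II_def
proof (intro SUP_least INF_greatest)
  fix S T :: "'a strategy" assume "S \<in> strategies s" "T \<in> strategies s"
  then show "(INF T\<in>strategies s. F_minus Y F x S T) \<le> (SUP S\<in>strategies s. F_plus Y F x S T)"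
    by (meson F_minus_le_F_plus INF_lower SUP_upper order_trans)
qed

text \<open>Histories list the latest turn first, so the turn preceding the fresh game is appended
  at the end. The continued game serves as supermartingale for the fresh one; this one inequality
  suffices to bound the continued game from below.\<close>

lemma nn_integral_final_position_restart:
  fixes g :: "'a \<Rightarrow> ennreal"
  assumes S: "\<And>l. S1 (z, l) = S (x0, l @ [(b, z)])" and T: "\<And>l. T1 (z, l) = T (x0, l @ [(b, z)])"
  shows "(\<integral>\<^sup>+x. g x \<partial>measure_spmf (final_position Y S1 T1 (z, []))) \<le>
    (\<integral>\<^sup>+x. g x \<partial>measure_spmf (final_position Y S T (x0, [(b, z)])))"
proof -
  \<comment> \<open>Histories not starting at \<open>z\<close> get the value \<open>\<top>\<close>,
    for which the supermartingale inequality is trivial.\<close>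
  define \<Phi> where "\<Phi> = (\<lambda>h. if fst h = z
    then \<integral>\<^sup>+x. g x \<partial>measure_spmf (final_position Y S T (x0, snd h @ [(b, z)])) else \<top>)"
  have pos: "position (x0, snd h @ [(b, z)]) = position h" if "fst h = z" for h
    using that by (cases h; cases "snd h") (auto simp: position_def)
  have "(\<integral>\<^sup>+x. g x \<partial>measure_spmf (final_position Y S1 T1 (z, []))) \<le> \<Phi> (z, [])"
  proof (rule nn_integral_final_position_le)
    fix h assume "position h \<in> Y"
    then show "g (position h) \<le> \<Phi> h"
      using pos[of h] by (auto simp: \<Phi>_def final_position_stop measure_spmf_return_spmf nn_integral_return)
  next
    fix h assume hY: "position h \<notin> Y"
    show "((\<integral>\<^sup>+x. \<Phi> (extend_game h True x) \<partial>measure_pmf (S1 h)) +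
      (\<integral>\<^sup>+x. \<Phi> (extend_game h False x) \<partial>measure_pmf (T1 h))) / 2 \<le> \<Phi> h"
    proof (cases "fst h = z")
      case True
      then have "h = (z, snd h)" by (cases h) simp
      then have "S1 h = S (x0, snd h @ [(b, z)])" "T1 h = T (x0, snd h @ [(b, z)])"
        using S T by metis+
      moreover have "position (x0, snd h @ [(b, z)]) \<notin> Y" using pos[OF True] hY by simp
      ultimately show ?thesis
        using True by (simp add: \<Phi>_def extend_game_def nn_integral_final_position)
    qed (simp add: \<Phi>_def)
  qed
  then show ?thesis by (simp add: \<Phi>_def)
qed

context tug
begin

text \<open>On \<open>Y\<close> the negative part of \<open>F\<close> is bounded, so the expectation
  exists, possibly infinite, and shifting by \<open>m\<close> reduces it to one nonnegative
  integral.\<close>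

lemma ext_expectation_eq:
  assumes p: "lossless_spmf p" "set_spmf p \<subseteq> Y"
  shows "expectation_exists p F"
    and "ext_expectation p F = enn2ereal (\<integral>\<^sup>+x. ennreal (F x - m) \<partial>measure_spmf p) + ereal m"
proof -
  have AE: "AE x in measure_spmf p. m \<le> F x" using p(2) F_ge by (auto simp: AE_measure_spmf_iff)
  have 1: "(\<integral>\<^sup>+x. c \<partial>measure_spmf p) = c" for c
    using p(1) by (simp add: lossless_spmf_def measure_spmf.emeasure_eq_measure space_measure_spmf)
  have "pos_expectation p (\<lambda>x. - F x) \<le> (\<integral>\<^sup>+x. ennreal (max 0 (- m)) \<partial>measure_spmf p)"
    unfolding pos_expectation_def
    by (rule nn_integral_mono_AE) (use AE in \<open>auto intro!: ennreal_leI elim!: AE_mp\<close>)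
  then have fin: "pos_expectation p (\<lambda>x. - F x) < \<infinity>" unfolding 1 by (simp add: order_le_less_trans)
  then show "expectation_exists p F" by (simp add: expectation_exists_def)
  have "(\<integral>\<^sup>+x. (ennreal (F x - m) + ennreal (max 0 (- F x))) + ennreal (max 0 m) \<partial>measure_spmf p) =
    (\<integral>\<^sup>+x. ennreal (max 0 (F x)) + ennreal (max 0 (- m)) \<partial>measure_spmf p)"
  proof (rule nn_integral_cong_AE, use AE in eventually_elim)
    fix x assume "m \<le> F x"
    moreover have "F x - m + max 0 (- F x) + max 0 m = max 0 (F x) + max 0 (- m)" by (simp add: max_def)
    ultimately show "(ennreal (F x - m) + ennreal (max 0 (- F x))) + ennreal (max 0 m) = ennreal (max 0 (F x)) + ennreal (max 0 (- m))"
      by (metis add_nonneg_nonneg diff_ge_0_iff_ge ennreal_plus max.cobounded1)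
  qed
  then have eq: "((\<integral>\<^sup>+x. ennreal (F x - m) \<partial>measure_spmf p) + pos_expectation p (\<lambda>x. - F x)) + ennreal (max 0 m)
      = pos_expectation p F + ennreal (max 0 (- m))"
    by (simp add: nn_integral_add 1 pos_expectation_def del: nn_integral_const)
  obtain b where b: "0 \<le> b" "pos_expectation p (\<lambda>x. - F x) = ennreal b"
    using fin by (cases "pos_expectation p (\<lambda>x. - F x)") auto
  define c where "c = (\<integral>\<^sup>+x. ennreal (F x - m) \<partial>measure_spmf p)"
  show "ext_expectation p F = enn2ereal (\<integral>\<^sup>+x. ennreal (F x - m) \<partial>measure_spmf p) + ereal m"
  proof (cases c)
    case top
    then have "pos_expectation p F + ennreal (max 0 (- m)) = \<top>" using eq unfolding c_def[symmetric] by (simp add: top_add)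
    then have "pos_expectation p F = \<top>" by (metis ennreal_add_eq_top ennreal_neq_top)
    then show ?thesis using top unfolding c_def[symmetric] ext_expectation_def by (simp add: b)
  next
    case (real c')
    then have "pos_expectation p F \<noteq> \<top>" using eq b unfolding c_def[symmetric]
      by (metis ennreal_add_eq_top ennreal_neq_top)
    then obtain a where a: "0 \<le> a" "pos_expectation p F = ennreal a" by (cases "pos_expectation p F") auto
    have "ennreal (c' + b + max 0 m) = ennreal (a + max 0 (- m))"
      using eq real a b unfolding c_def[symmetric] by (simp add: ennreal_plus)
    then have "c' + b + max 0 m = a + max 0 (- m)" using real a b by (subst (asm) ennreal_inj) auto
    then have "a - b = c' + m" by (auto simp: max_def split: if_splits)
    then show ?thesis using real a b unfolding c_def[symmetric] ext_expectation_def
      by (simp add: enn2ereal_ennreal)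
  qed
qed

definition payoff :: "'a strategy \<Rightarrow> 'a strategy \<Rightarrow> 'a partial_game \<Rightarrow> ennreal" where
  "payoff S T h = (\<integral>\<^sup>+x. ennreal (F x - m) \<partial>measure_spmf (final_position Y S T h))"

lemma F_minus_eq:
  "F_minus Y F x S T =
    (if lossless_spmf (final_position Y S T (x, [])) then enn2ereal (payoff S T (x, [])) + ereal m else -\<infinity>)"
  using ext_expectation_eq[OF _ set_final_position]
  by (auto simp: F_minus_def Let_def payoff_def)

lemma F_plus_eq:
  "F_plus Y F x S T =
    (if lossless_spmf (final_position Y S T (x, [])) then enn2ereal (payoff S T (x, [])) + ereal m else \<infinity>)"
  using ext_expectation_eq[OF _ set_final_position]
  by (auto simp: F_plus_def Let_def payoff_def)

lemma value_II_le:
  assumes s: "0 < s" and W: "W \<in> supersolutions s"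
  shows "value_II Y F s x0 \<le> ereal (W x0)"
proof (rule ereal_le_epsilon2)
  fix \<eta> :: real assume \<eta>: "0 < \<eta>"
  obtain W' \<delta> where W': "W' \<in> supersolutions s" and \<delta>: "0 < \<delta>" and "W' x0 \<le> W x0 + \<eta> / 2"
    and down: "\<And>x. x \<notin> Y \<Longrightarrow> lo s W' x \<le> W' x - \<delta>"
    using strict_supersolution[OF s W half_gt_zero[OF \<eta>]] by metis
  define \<epsilon> where "\<epsilon> = min (\<eta> / 2) \<delta>"
  have \<epsilon>: "0 < \<epsilon>" "\<epsilon> \<le> \<eta> / 2" "\<epsilon> \<le> \<delta>" using \<eta> \<delta> by (auto simp: \<epsilon>_def)
  \<comment> \<open>Player II errs by at most \<open>e h\<close>, and only after winning the toss;
    the expected loss \<open>e h / 2\<close> is what the summand \<open>e\<close> in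
    \<open>\<phi>\<close> releases in each turn.\<close>
  define e :: "'a partial_game \<Rightarrow> real" where "e = (\<lambda>h. \<epsilon> * (1/2) ^ length (snd h))"
  have e: "0 < e h" "e h \<le> \<epsilon>" "e (extend_game h b x) = e h / 2" for h b x
    using \<epsilon>(1) by (auto simp: e_def extend_game_def power_le_one mult_left_le)
  define mv where "mv = (\<lambda>h. SOME y. dist (position h) y < s \<and> W' y < lo s W' (position h) + e h)"
  have mv: "dist (position h) (mv h) < s" "W' (mv h) < lo s W' (position h) + e h" for h
  proof -
    have "\<exists>y. dist (position h) y < s \<and> W' y < lo s W' (position h) + e h"
      using lo_less[OF s, of W' "position h"] e(1)[of h] by (metis less_add_same_cancel1)
    from someI_ex[OF this] show "dist (position h) (mv h) < s" "W' (mv h) < lo s W' (position h) + e h"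
      unfolding mv_def by auto
  qed
  define T where "T = (\<lambda>h. return_pmf (mv h))"
  have T: "T \<in> strategies s" using mv(1) by (auto simp: strategies_def T_def dist_commute)
  define \<phi> where "\<phi> = (\<lambda>h. W' (position h) - m + e h)"
  have \<phi>_pos: "0 \<le> \<phi> h" for h using supersolutionsD(1)[OF W'] e(1)[of h] by (simp add: \<phi>_def add_nonneg_nonneg less_imp_le)
  have "F_plus Y F x0 S T \<le> ereal (W x0 + \<eta>)" if S: "S \<in> strategies s" for S
  proof -
    have step: "\<exists>D\<ge>\<delta> / 2. (\<forall>x\<in>set_pmf (T h). \<phi> (extend_game h False x) \<le> \<phi> h - D) \<and>
        (\<forall>x\<in>set_pmf (S h). \<phi> (extend_game h True x) \<le> \<phi> h + D)" if h: "position h \<notin> Y" for h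
    proof (intro exI conjI ballI)
      let ?x = "position h"
      let ?D = "W' ?x - lo s W' ?x - e h / 2"
      show "\<delta> / 2 \<le> ?D" using down[OF h] e(2)[of h] \<epsilon>(3) by argo
      fix x assume "x \<in> set_pmf (T h)"
      then show "\<phi> (extend_game h False x) \<le> \<phi> h - ?D"
        using mv(2)[of h] e(3)[of h False x] unfolding \<phi>_def by (simp add: T_def)
    next
      let ?x = "position h"
      let ?D = "W' ?x - lo s W' ?x - e h / 2"
      fix x assume "x \<in> set_pmf (S h)"
      then have "dist ?x x < s" using strategiesD[OF S] by blast
      then have "W' x + lo s W' ?x \<le> 2 * W' ?x"
        using supersolutionsD(3)[OF W' h] by (simp add: superharmonic_at_def)
      then show "\<phi> (extend_game h True x) \<le> \<phi> h + ?D"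
        using e(3)[of h True x] unfolding \<phi>_def by simp
    qed
    have loss: "lossless_spmf (final_position Y S T (x0, []))"
      by (rule lossless_final_position[where \<Phi>=\<phi> and c="\<delta> / 2" and b=False])
         (use \<phi>_pos \<delta> step in auto)
    have "payoff S T (x0, []) \<le> ennreal (\<phi> (x0, []))"
      unfolding payoff_def
    proof (rule nn_integral_final_position_le)
      fix h :: "'a partial_game" assume "position h \<in> Y"
      then show "ennreal (F (position h) - m) \<le> ennreal (\<phi> h)"
        using supersolutionsD(2)[OF W'] e(1)[of h] by (intro ennreal_leI) (fastforce simp: \<phi>_def)
    next
      fix h :: "'a partial_game" assume h: "position h \<notin> Y"
      obtain D where D: "\<And>x. x \<in> set_pmf (T h) \<Longrightarrow> \<phi> (extend_game h False x) \<le> \<phi> h - D"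
        "\<And>x. x \<in> set_pmf (S h) \<Longrightarrow> \<phi> (extend_game h True x) \<le> \<phi> h + D" "\<delta> / 2 \<le> D"
        using step[OF h] by blast
      have D0: "0 \<le> \<phi> h - D" "0 \<le> \<phi> h + D"
        using D(1)[of "mv h"] D(3) \<phi>_pos[of "extend_game h False (mv h)"] \<phi>_pos[of h] \<delta> by (auto simp: T_def)
      have "((\<integral>\<^sup>+x. ennreal (\<phi> (extend_game h True x)) \<partial>measure_pmf (S h)) +
        (\<integral>\<^sup>+x. ennreal (\<phi> (extend_game h False x)) \<partial>measure_pmf (T h))) / 2
        \<le> (ennreal (\<phi> h + D) + ennreal (\<phi> h - D)) / 2"
        using D by (intro divide_right_mono_ennreal add_mono nn_integral_measure_pmf_le ennreal_leI)
      also have "\<dots> = ennreal (\<phi> h)"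
        using D0 \<phi>_pos[of h] by (simp flip: ennreal_plus add: ennreal_divide_numeral)
      finally show "((\<integral>\<^sup>+x. ennreal (\<phi> (extend_game h True x)) \<partial>measure_pmf (S h)) +
        (\<integral>\<^sup>+x. ennreal (\<phi> (extend_game h False x)) \<partial>measure_pmf (T h))) / 2 \<le> ennreal (\<phi> h)" .
    qed
    then have "enn2ereal (payoff S T (x0, [])) + ereal m \<le> ereal (\<phi> (x0, []) + m)"
      using \<phi>_pos[of "(x0, [])"] 
      by (metis add_right_mono enn2ereal_ennreal less_eq_ennreal.rep_eq plus_ereal.simps(1))
    also have "\<dots> \<le> ereal (W x0 + \<eta>)"
      using \<open>W' x0 \<le> W x0 + \<eta> / 2\<close> \<epsilon>(2) by (simp add: \<phi>_def position_def e_def)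
    finally show ?thesis using loss by (simp add: F_plus_eq)
  qed
  then have "(SUP S\<in>strategies s. F_plus Y F x0 S T) \<le> ereal (W x0 + \<eta>)" by (intro SUP_least)
  then show "value_II Y F s x0 \<le> ereal (W x0) + ereal \<eta>"
    unfolding value_II_def using T by (auto intro: INF_lower2)
qed

text \<open>Player I walks towards a fixed point of \<open>Y\<close>: the number of steps falls by
  at least one on a won turn and rises by at most one on a lost one, which forces the game to end.
  This rules out the value \<open>-\<infinity>\<close> given to endless plays.\<close>

lemma value_I_ge_m:
  assumes s: "0 < s" shows "ereal m \<le> value_I Y F s x"
proof -
  obtain y0 where y0: "y0 \<in> Y" using Y_ne by blast
  define mv where "mv = (\<lambda>h. SOME p. dist (position h) p < s \<and> (position h \<noteq> y0 \<longrightarrow> Suc (steps s p y0) \<le> steps s (position h) y0))"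
  have mv: "dist (position h) (mv h) < s" "position h \<noteq> y0 \<Longrightarrow> Suc (steps s (mv h) y0) \<le> steps s (position h) y0" for h
  proof -
    have "\<exists>p. dist (position h) p < s \<and> (position h \<noteq> y0 \<longrightarrow> Suc (steps s p y0) \<le> steps s (position h) y0)"
      by (metis dist_self s steps_descend[OF len s])
    from someI_ex[OF this]
    show "dist (position h) (mv h) < s" "position h \<noteq> y0 \<Longrightarrow> Suc (steps s (mv h) y0) \<le> steps s (position h) y0"
      unfolding mv_def by auto
  qed
  define S where "S = (\<lambda>h. return_pmf (mv h))"
  have S: "S \<in> strategies s" using mv(1) by (auto simp: strategies_def S_def dist_commute)
  have "ereal m \<le> F_minus Y F x S T" if T: "T \<in> strategies s" for T
  proof -
    have "lossless_spmf (final_position Y S T (x, []))"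
    proof (rule lossless_final_position[where \<Phi>="\<lambda>h. real (steps s (position h) y0)" and c=1 and b=True])
      fix h :: "'a partial_game" assume h: "position h \<notin> Y"
      have "real (steps s z y0) \<le> real (steps s (position h) y0) + 1" if "z \<in> set_pmf (T h)" for z
        using steps_triangle_1[OF s, of z "position h" y0] strategiesD[OF T that] by (simp add: dist_commute)
      moreover have "Suc (steps s (mv h) y0) \<le> steps s (position h) y0" using mv(2)[of h] h y0 by metis
      ultimately show "\<exists>D\<ge>1. (\<forall>z\<in>set_pmf (if True then S h else T h).
          real (steps s (position (extend_game h True z)) y0) \<le> real (steps s (position h) y0) - D) \<and>
        (\<forall>z\<in>set_pmf (if True then T h else S h).
          real (steps s (position (extend_game h (\<not> True) z)) y0) \<le> real (steps s (position h) y0) + D)"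
        by (intro exI[of _ 1]) (auto simp: S_def)
    qed auto
    then show ?thesis by (simp add: F_minus_eq add_increasing)
  qed
  then have "ereal m \<le> (INF T\<in>strategies s. F_minus Y F x S T)" by (intro INF_greatest)
  also have "\<dots> \<le> value_I Y F s x" unfolding value_I_def using S by (intro SUP_upper)
  finally show ?thesis .
qed

lemma value_I_on_Y:
  assumes s: "0 < s" and y: "y \<in> Y" shows "ereal (F y) \<le> value_I Y F s y"
proof -
  define S :: "'a strategy" where "S = (\<lambda>h. return_pmf (position h))"
  have S: "S \<in> strategies s" using s by (auto simp: strategies_def S_def)
  have "F_minus Y F y S T = ereal (F y)" for T
    using y F_ge[OF y]
    by (simp add: F_minus_eq payoff_def final_position_stop position_def measure_spmf_return_spmf
        nn_integral_return enn2ereal_ennreal)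
  then have "ereal (F y) \<le> (INF T\<in>strategies s. F_minus Y F y S T)" by (intro INF_greatest) simp
  also have "\<dots> \<le> value_I Y F s y" unfolding value_I_def using S by (intro SUP_upper)
  finally show ?thesis .
qed

text \<open>Player I tries to move to \<open>p\<close> and then plays nearly optimally from wherever
  the first turn ended. The opponent's later replies form a strategy \<open>T1\<close> of a fresh
  game, so each branch can be bounded by restarting.\<close>

lemma value_I_superharmonic:
  assumes s: "0 < s" and r: "\<And>x. value_I Y F s x = ereal (r x)" and x: "x \<notin> Y"
  shows "superharmonic_at s r x"
  unfolding superharmonic_at_def
proof (intro allI impI)
  fix p assume p: "dist x p < s"
  have mr: "\<forall>x. m \<le> r x" using value_I_ge_m[OF s] r by (metis ereal_less_eq(3))
  have "(r p + lo s r x) / 2 \<le> r x"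
  proof (rule field_le_epsilon)
    fix \<eta> :: real assume \<eta>: "0 < \<eta>"
    have "\<exists>S\<in>strategies s. \<forall>T\<in>strategies s. ereal (r z - \<eta>) \<le> F_minus Y F z S T" for z
    proof -
      have "ereal (r z - \<eta>) < (SUP S\<in>strategies s. INF T\<in>strategies s. F_minus Y F z S T)"
        using r[of z] \<eta> unfolding value_I_def by simp
      then show ?thesis unfolding less_SUP_iff by (meson INF_lower less_imp_le order_trans)
    qed
    then obtain \<sigma> where \<sigma>: "\<And>z. \<sigma> z \<in> strategies s"
      "\<And>z T. T \<in> strategies s \<Longrightarrow> ereal (r z - \<eta>) \<le> F_minus Y F z (\<sigma> z) T" by metis
    \<comment> \<open>The oldest turn is \<open>last (snd h)\<close>; dropping it leaves the history
      of a game started at the position it reached. From a start other than \<open>x\<close> the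
      first move is to stay, a legal default.\<close>
    define S where "S = (\<lambda>h :: 'a partial_game. if snd h = [] then return_pmf (if fst h = x then p else fst h)
      else \<sigma> (snd (last (snd h))) (snd (last (snd h)), butlast (snd h)))"
    have S_simps: "S (x, []) = return_pmf p" "S (x, l @ [(b, z)]) = \<sigma> z (z, l)" for b l z
      by (simp_all add: S_def)
    have pos: "position (snd (last l), butlast l) = position (z, l)" if "l \<noteq> []" for l :: "(bool \<times> 'a) list" and z
      using that by (cases l) (auto simp: position_def split: if_splits list.splits)
    have S: "S \<in> strategies s"
    proof -
      have "set_pmf (S h) \<subseteq> {y. dist y (position h) < s}" for h
      proof (cases "snd h = []")
        case True
        then show ?thesis using p s by (auto simp: S_def position_def dist_commute)
      next
        case False
        then show ?thesis
          using strategiesD[OF \<sigma>(1), of _ "snd (last (snd h))" "(snd (last (snd h)), butlast (snd h))"] pos[OF False, of "fst h"]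
          by (auto simp: S_def dist_commute)
      qed
      then show ?thesis by (simp add: strategies_def)
    qed
    have "ereal ((r p + lo s r x) / 2 - \<eta>) \<le> F_minus Y F x S T" if T: "T \<in> strategies s" for T
    proof -
      have branch: "weight_spmf (final_position Y S T (x, [(b, z)])) = 1 \<and>
          ennreal (r z - \<eta> - m) \<le> payoff S T (x, [(b, z)])" for b z
      proof -
        define T1 where "T1 = (\<lambda>h :: 'a partial_game. T (x, snd h @ [(b, fst h)]))"
        have "position (x, snd h @ [(b, fst h)]) = position h" for h :: "'a partial_game"
          by (cases "snd h") (auto simp: position_def)
        then have "T1 \<in> strategies s" using T by (fastforce simp: strategies_def T1_def)
        from \<sigma>(2)[OF this] have F: "ereal (r z - \<eta>) \<le> F_minus Y F z (\<sigma> z) T1" .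
        then have loss: "lossless_spmf (final_position Y (\<sigma> z) T1 (z, []))"
          and pay: "ereal (r z - \<eta>) \<le> enn2ereal (payoff (\<sigma> z) T1 (z, [])) + ereal m"
          by (auto simp: F_minus_eq split: if_splits)
        note restart = nn_integral_final_position_restart[where ?S1.0="\<sigma> z" and ?T1.0=T1 and S=S and T=T and ?x0.0=x and b=b and z=z and Y=Y]
        have "weight_spmf (final_position Y (\<sigma> z) T1 (z, [])) \<le> weight_spmf (final_position Y S T (x, [(b, z)]))"
          using restart[of "\<lambda>_. 1"] by (simp add: S_simps T1_def flip: weight_spmf_eq_nn_integral del: nn_integral_const)
        then have "weight_spmf (final_position Y S T (x, [(b, z)])) = 1"
          using loss weight_spmf_le_1[of "final_position Y S T (x, [(b, z)])"] unfolding lossless_spmf_def by linarith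
        moreover have "payoff (\<sigma> z) T1 (z, []) \<le> payoff S T (x, [(b, z)])"
          unfolding payoff_def by (rule restart) (simp_all add: S_simps T1_def)
        moreover have "ennreal (r z - \<eta> - m) \<le> payoff (\<sigma> z) T1 (z, [])"
        proof (cases "payoff (\<sigma> z) T1 (z, [])")
          case (real c)
          then have "r z - \<eta> - m \<le> c" using pay by (simp add: enn2ereal_ennreal)
          then have "ennreal (r z - \<eta> - m) \<le> ennreal c" by (rule ennreal_leI)
          then show ?thesis using real by simp
        qed simp
        ultimately show ?thesis by simp
      qed
      have x': "position (x, []) \<notin> Y" using x by (simp add: position_def)
      have "(1 + 1) / 2 \<le> weight_spmf (final_position Y S T (x, []))"
        by (rule weight_final_position_ge[OF x']) (simp_all add: branch extend_game_def)
      then have loss: "lossless_spmf (final_position Y S T (x, []))"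
        unfolding lossless_spmf_def using weight_spmf_le_1[of "final_position Y S T (x, [])"] by simp
      have "ennreal ((r p + lo s r x) / 2 - \<eta> - m) \<le> (ennreal (r p - \<eta> - m) + ennreal (lo s r x - \<eta> - m)) / 2"
      proof -
        have "ennreal ((r p - \<eta> - m) + (lo s r x - \<eta> - m)) \<le> ennreal (r p - \<eta> - m) + ennreal (lo s r x - \<eta> - m)"
          by (smt (verit) ennreal_leI ennreal_neg ennreal_plus add_0 add_0_right zero_le)
        from divide_right_mono_ennreal[OF this, of 2]
        show ?thesis
          by (cases "0 \<le> (r p + lo s r x) / 2 - \<eta> - m")
             (simp_all add: ennreal_divide_numeral ennreal_neg field_simps)
      qed
      also have "\<dots> \<le> payoff S T (x, [])"
        unfolding payoff_def nn_integral_final_position[OF x']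
      proof (intro divide_right_mono_ennreal add_mono nn_integral_measure_pmf_ge)
        fix z assume "z \<in> set_pmf (S (x, []))"
        then show "ennreal (r p - \<eta> - m) \<le> (\<integral>\<^sup>+y. ennreal (F y - m) \<partial>measure_spmf (final_position Y S T (extend_game (x, []) True z)))"
          using branch[of True p] by (simp add: S_simps payoff_def extend_game_def)
      next
        fix z assume "z \<in> set_pmf (T (x, []))"
        then have "dist x z < s" using strategiesD[OF T, of z "(x, [])"] by (simp add: position_def)
        then have "lo s r x \<le> r z" using lo_le[OF mr] by blast
        then have "ennreal (lo s r x - \<eta> - m) \<le> ennreal (r z - \<eta> - m)" by (intro ennreal_leI) simp
        also have "\<dots> \<le> payoff S T (x, [(False, z)])" using branch by blast
        finally show "ennreal (lo s r x - \<eta> - m) \<le> (\<integral>\<^sup>+y. ennreal (F y - m) \<partial>measure_spmf (final_position Y S T (extend_game (x, []) False z)))"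
          by (simp add: payoff_def extend_game_def)
      qed
      finally have "ennreal ((r p + lo s r x) / 2 - \<eta> - m) \<le> payoff S T (x, [])" .
      then have "ereal ((r p + lo s r x) / 2 - \<eta>) \<le> enn2ereal (payoff S T (x, [])) + ereal m"
      proof (cases "payoff S T (x, [])")
        case (real c)
        with \<open>ennreal _ \<le> payoff S T (x, [])\<close> have "(r p + lo s r x) / 2 - \<eta> - m \<le> c"
          by (simp add: ennreal_le_iff)
        then show ?thesis using real by (simp add: enn2ereal_ennreal)
      qed simp
      then show ?thesis using loss by (simp add: F_minus_eq)
    qed
    then have "ereal ((r p + lo s r x) / 2 - \<eta>) \<le> (INF T\<in>strategies s. F_minus Y F x S T)"
      by (intro INF_greatest)
    also have "\<dots> \<le> value_I Y F s x" unfolding value_I_def using S by (intro SUP_upper)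
    finally have "(r p + lo s r x) / 2 - \<eta> \<le> r x" using r[of x] by simp
    then show "(r p + lo s r x) / 2 \<le> r x + \<eta>" by argo
  qed
  then show "r p + lo s r x \<le> 2 * r x" by simp
qed

theorem game_value:
  assumes s: "0 < s"
  shows "value_I Y F s x = ereal (u s x)" "value_II Y F s x = ereal (u s x)"
proof -
  have II: "value_II Y F s x \<le> ereal (u s x)" for x by (rule value_II_le[OF s u_supersolution[OF s]])
  define r where "r = (\<lambda>x. real_of_ereal (value_I Y F s x))"
  have r: "value_I Y F s x = ereal (r x)" for x
  proof -
    have "value_I Y F s x \<noteq> \<infinity>" "value_I Y F s x \<noteq> -\<infinity>"
      using II[of x] value_I_le_value_II[of Y F s x] value_I_ge_m[OF s, of x] by auto
    then show ?thesis unfolding r_def by (cases "value_I Y F s x") auto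
  qed
  have "r \<in> supersolutions s"
    unfolding supersolutions_def
    using value_I_ge_m[OF s] value_I_on_Y[OF s] value_I_superharmonic[OF s r] by (auto simp: r)
  then have "ereal (u s x) \<le> value_I Y F s x" using u_le r by simp
  then show "value_I Y F s x = ereal (u s x)" "value_II Y F s x = ereal (u s x)"
    using II[of x] value_I_le_value_II[of Y F s x] by auto
qed

end

section \<open>Comparison of scales\<close>

lemma lo_le_lo_add:
  assumes "0 < s" "\<forall>x. m \<le> v x" "\<And>y. dist x y < s \<Longrightarrow> v y \<le> w y + c"
  shows "lo s v x \<le> lo s w x + c"
proof -
  have "lo s v x - c \<le> lo s w x"
  proof (rule lo_greatest[OF assms(1)])
    fix y assume "dist x y < s"
    with lo_le[OF assms(2) this] assms(3) show "lo s v x - c \<le> w y" by fastforce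
  qed
  then show ?thesis by simp
qed

lemma lo_ge_m: "0 < s \<Longrightarrow> \<forall>x. m \<le> w x \<Longrightarrow> \<forall>x. m \<le> lo s w x"
  by (auto intro: lo_greatest)

text \<open>A point \<open>z\<close> near \<open>x\<close> is within \<open>2 * s\<close> of every
  \<open>y\<close> in the ball about \<open>x\<close>; an intermediate point \<open>p\<close> lets
  superharmonicity at \<open>y\<close> control \<open>lo s w z\<close>.\<close>

lemma superharmonic_at_lo:
  fixes w :: "'a::metric_space \<Rightarrow> real"
  assumes len: "length_space TYPE('a)" and s: "0 < s" and m: "\<forall>x. m \<le> w x"
    and sh: "\<And>y. dist x y < s \<Longrightarrow> superharmonic_at s w y"
  shows "superharmonic_at s (lo s w) x"
  unfolding superharmonic_at_def
proof (intro allI impI)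
  fix z assume z: "dist x z < s"
  have "(lo s w z + lo s (lo s w) x) / 2 \<le> lo s w x"
  proof (rule lo_greatest[OF s])
    fix y assume y: "dist x y < s"
    have "dist y z < s + s" using y z dist_triangle2[of y z x] by (simp add: dist_commute)
    then obtain p where p: "dist y p < s" "dist p z < s" using length_space_split[OF len] s by metis
    have "lo s w z \<le> w p" using lo_le[OF m, of z p s] p by (simp add: dist_commute)
    moreover have "w p + lo s w y \<le> 2 * w y" by (rule superharmonic_atD[OF sh[OF y] p(1)])
    moreover have "lo s (lo s w) x \<le> lo s w y" by (rule lo_le[OF lo_ge_m[OF s m] y])
    ultimately show "(lo s w z + lo s (lo s w) x) / 2 \<le> w y" by argo
  qed
  then show "lo s w z + lo s (lo s w) x \<le> 2 * lo s w x" by argo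
qed

text \<open>Concavity of the ball minimum in the radius, in steps of \<open>s\<close>: from any
  \<open>y\<close> near \<open>x\<close> the move back to \<open>x\<close> is among those that
  superharmonicity at \<open>y\<close> controls.\<close>

lemma lo_concave:
  assumes s: "0 < s" and m: "\<forall>x. m \<le> v x"
    and sh: "\<And>y. dist x y < s \<Longrightarrow> superharmonic_at s v y"
  shows "v x + lo s (lo s v) x \<le> 2 * lo s v x"
proof -
  have "(v x + lo s (lo s v) x) / 2 \<le> lo s v x"
  proof (rule lo_greatest[OF s])
    fix y assume y: "dist x y < s"
    have "v x + lo s v y \<le> 2 * v y" by (rule superharmonic_atD[OF sh[OF y]]) (use y in \<open>simp add: dist_commute\<close>)
    moreover have "lo s (lo s v) x \<le> lo s v y" by (rule lo_le[OF lo_ge_m[OF s m] y])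
    ultimately show "(v x + lo s (lo s v) x) / 2 \<le> v y" by argo
  qed
  then show ?thesis by argo
qed

lemma lo_iterate_ge_m: "0 < s \<Longrightarrow> \<forall>x. m \<le> w x \<Longrightarrow> \<forall>x. m \<le> (lo s ^^ k) w x"
  by (induction k) (simp_all add: lo_ge_m)

lemma lo_iterate:
  fixes w :: "'a::metric_space \<Rightarrow> real"
  assumes len: "length_space TYPE('a)" and s: "0 < s" and m: "\<forall>x. m \<le> w x"
  shows "(lo s ^^ Suc k) w = lo (real (Suc k) * s) w"
proof (induction k)
  case (Suc k)
  have "(lo s ^^ Suc (Suc k)) w x = lo (s + real (Suc k) * s) w x" for x
    using Suc s by (simp del: of_nat_Suc add: lo_lo[OF len m s])
  then show ?case by (auto simp: fun_eq_iff algebra_simps)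
qed simp

lemma superharmonic_at_lo_iterate:
  fixes w :: "'a::metric_space \<Rightarrow> real"
  assumes len: "length_space TYPE('a)" and s: "0 < s" and m: "\<forall>x. m \<le> w x"
    and sh: "\<And>y. dist x y < real (Suc k) * s \<Longrightarrow> superharmonic_at s w y"
  shows "superharmonic_at s ((lo s ^^ k) w) x"
  using sh
proof (induction k arbitrary: x)
  case 0
  then show ?case using s by simp
next
  case (Suc k)
  have "superharmonic_at s ((lo s ^^ k) w) y" if "dist x y < s" for y
  proof (rule Suc.IH)
    fix z assume "dist y z < real (Suc k) * s"
    then have "dist x z < real (Suc (Suc k)) * s" using that dist_triangle[of x z y] by (simp add: algebra_simps)
    then show "superharmonic_at s w z" by (rule Suc.prems)
  qed
  then show ?case using superharmonic_at_lo[OF len s lo_iterate_ge_m[OF s m]] by simp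
qed

text \<open>The drops \<open>g i - g (Suc i)\<close> are nondecreasing, so the first
  \<open>k\<close> of them sum to no more than the next \<open>k\<close>, and the first is at most
  the last.\<close>

lemma concave_sequence:
  fixes g :: "nat \<Rightarrow> real"
  assumes "\<And>i. i < 2 * k \<Longrightarrow> g i + g (Suc (Suc i)) \<le> 2 * g (Suc i)"
  shows "2 * g 0 - g 1 + g (2 * k + 1) \<le> 2 * g k"
proof -
  define d where "d = (\<lambda>i. g i - g (Suc i))"
  have mono: "i \<le> j \<Longrightarrow> j \<le> 2 * k \<Longrightarrow> d i \<le> d j" for i j
  proof (induction j rule: dec_induct)
    case (step j)
    then show ?case using assms[of j] by (simp add: d_def)
  qed simp
  have "g 0 - g j = (\<Sum>i<j. d i)" for j by (induction j) (simp_all add: d_def)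
  moreover have "g k - g (k + j) = (\<Sum>i<j. d (k + i))" for j by (induction j) (simp_all add: d_def)
  moreover have "(\<Sum>i<k. d i) \<le> (\<Sum>i<k. d (k + i))" by (intro sum_mono mono) auto
  ultimately have "g 0 - g k \<le> g k - g (2 * k)" by (metis mult_2)
  moreover have "d 0 \<le> d (2 * k)" by (rule mono) auto
  moreover have "d 0 = g 0 - g 1" "d (2 * k) = g (2 * k) - g (2 * k + 1)" by (simp_all add: d_def)
  ultimately show ?thesis by linarith
qed

text \<open>Superharmonicity of \<open>(lo s ^^ k) w\<close> on scale \<open>Suc k * s\<close>: its
  own minimum over the larger ball is the iterate \<open>2 * k + 1\<close>.\<close>

lemma superharmonic_scale_up:
  fixes w :: "'a::metric_space \<Rightarrow> real"
  assumes len: "length_space TYPE('a)" and s: "0 < s" and m: "\<forall>x. m \<le> w x"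
    and sh: "\<And>y. dist x y < real (2 * Suc k) * s \<Longrightarrow> superharmonic_at s w y"
    and z: "dist x z < real (Suc k) * s"
  shows "(lo s ^^ k) w z + (lo s ^^ (2 * k + 1)) w x \<le> 2 * (lo s ^^ k) w x"
proof -
  have "2 * (lo s ^^ 0) w x - (lo s ^^ 1) w x + (lo s ^^ (2 * k + 1)) w x \<le> 2 * (lo s ^^ k) w x"
  proof (rule concave_sequence)
    fix i assume i: "i < 2 * k"
    have "superharmonic_at s ((lo s ^^ i) w) y" if "dist x y < s" for y
    proof (rule superharmonic_at_lo_iterate[OF len s m])
      fix z assume "dist y z < real (Suc i) * s"
      then have "dist x z < (real (Suc i) + 1) * s" using that dist_triangle[of x z y] by (simp add: algebra_simps)
      also have "\<dots> \<le> real (2 * Suc k) * s" using i s by (intro mult_right_mono) auto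
      finally show "superharmonic_at s w z" by (rule sh)
    qed
    then show "(lo s ^^ i) w x + (lo s ^^ Suc (Suc i)) w x \<le> 2 * (lo s ^^ Suc i) w x"
      using lo_concave[OF s lo_iterate_ge_m[OF s m]] by simp
  qed
  moreover obtain p where p: "dist x p < s" "(lo s ^^ k) w z \<le> w p"
  proof (cases k)
    case 0
    then show thesis using that[of z] z by simp
  next
    case (Suc j)
    have "dist x z < s + real k * s" using z by (simp add: algebra_simps)
    then obtain p where "dist x p < s" "dist p z < real k * s"
      using length_space_split[OF len, of x z s "real k * s"] s Suc by auto
    then show thesis using that[of p] lo_le[OF m, of z p "real k * s"]
      unfolding Suc lo_iterate[OF len s m] by (simp add: dist_commute)
  qed
  moreover have "w p + lo s w x \<le> 2 * w x"
  proof (rule superharmonic_atD[OF sh p(1)])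
    show "dist x x < real (2 * Suc k) * s" using s by simp
  qed
  ultimately show ?thesis by simp
qed

context tug
begin

text \<open>Near \<open>Y\<close>, where \<open>V\<close> need not be superharmonic, the upper cone takes over.\<close>

lemma u_le_of_superharmonic_away:
  assumes s: "0 < s" and m: "\<forall>x. m \<le> V x" and K: "0 < K" and B: "0 \<le> B"
    and sh: "\<And>x. (\<And>y. y \<in> Y \<Longrightarrow> K \<le> dist x y) \<Longrightarrow> superharmonic_at s V x"
    and near: "\<And>x y. y \<in> Y \<Longrightarrow> dist x y < K \<Longrightarrow> F y - B \<le> V x"
  shows "u s x \<le> V x + (B + L * (K + s))"
proof -
  \<comment> \<open>\<open>B\<close> is the deficit of \<open>V\<close> below \<open>F\<close> near
    \<open>Y\<close>, and \<open>L * (K + s)\<close> bounds the rise of a cone with apex in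
    \<open>Y\<close> up to distance \<open>K\<close>. Hence the upper cone is the smaller function
    there.\<close>
  define C where "C = B + L * (K + s)"
  have C: "0 \<le> C" "B \<le> C" using B L_pos K s by (auto simp: C_def)
  define H where "H = (\<lambda>x. min (V x + C) (upper_cone s x))"
  note h = supersolutionsD[OF upper_cone_supersolution[OF s]]
  have mV: "\<forall>x. m \<le> V x + C" using m C(1) by (simp add: add_increasing2)
  have mH: "\<forall>x. m \<le> H x" using mV h(1) by (simp add: H_def)
  have "superharmonic_at s H x" if x: "x \<notin> Y" for x
  proof (cases "upper_cone s x \<le> V x + C")
    case True
    show ?thesis
      by (rule superharmonic_at_min[OF s mH h(3)[OF x]]) (use True in \<open>auto simp: H_def\<close>)
  next
    case False
    have "superharmonic_at s V x"
    proof (rule sh, rule ccontr)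
      fix y assume y: "y \<in> Y" "\<not> K \<le> dist x y"
      have "upper_cone s x \<le> F y + L * (s * real (steps s x y))" by (rule upper_cone_le[OF s y(1)])
      also have "\<dots> \<le> F y + L * (K + s)"
        using steps_le_dist[OF s, of x y] y(2) L_pos by (intro add_left_mono mult_left_mono) auto
      also have "\<dots> \<le> V x + C" using near[OF y(1), of x] y(2) by (simp add: C_def)
      finally show False using False by simp
    qed
    then have "superharmonic_at s (\<lambda>x. V x + C) x" by (rule superharmonic_at_add[OF s m])
    then show ?thesis
      by (rule superharmonic_at_min[OF s mH]) (use False in \<open>auto simp: H_def\<close>)
  qed
  moreover have "F y \<le> H y" if "y \<in> Y" for y
    using near[OF that, of y] K C(2) h(2)[OF that] by (simp add: H_def)
  ultimately have "H \<in> supersolutions s" using mH by (simp add: supersolutions_def)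
  from u_le[OF this, of x] show ?thesis by (simp add: H_def C_def)
qed

lemma u_ge_near_Y: "0 < s \<Longrightarrow> y \<in> Y \<Longrightarrow> F y - L * (dist x y + s) \<le> u s x"
  using u_lipschitz[of s x y] u_eq_F[of s y] by simp

text \<open>The doubling case of \<open>superharmonic_scale_up\<close>, which needs distance
  \<open>4 * s\<close> from \<open>Y\<close>. Nearer to \<open>Y\<close> the deficit is at most
  \<open>6 * L * s\<close>, and the cone adds another \<open>6 * L * s\<close>.\<close>

lemma u_double_le:
  assumes s: "0 < s" shows "u (2 * s) x \<le> u s x + 12 * L * s"
proof -
  let ?V = "lo s (u s)"
  note m = u_ge[OF s]
  have "u (2 * s) x \<le> ?V x + (6 * L * s + L * (4 * s + 2 * s))"
  proof (rule u_le_of_superharmonic_away)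
    show "\<forall>x. m \<le> ?V x" by (rule lo_ge_m[OF s m])
    fix x assume far: "\<And>y. y \<in> Y \<Longrightarrow> 4 * s \<le> dist x y"
    show "superharmonic_at (2 * s) ?V x"
      unfolding superharmonic_at_def
    proof (intro allI impI)
      fix z assume z: "dist x z < 2 * s"
      have "(lo s ^^ 1) (u s) z + (lo s ^^ (2 * 1 + 1)) (u s) x \<le> 2 * (lo s ^^ 1) (u s) x"
      proof (rule superharmonic_scale_up[OF len s m])
        fix y assume "dist x y < real (2 * Suc 1) * s"
        then have "y \<notin> Y" using far[of y] by auto
        then show "superharmonic_at s (u s) y" by (rule u_superharmonic[OF s])
      qed (use z in simp)
      moreover have "lo s (lo s ?V) x = lo (2 * s) ?V x"
        using lo_lo[OF len lo_ge_m[OF s m] s s, of x] by (metis mult_2)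
      ultimately show "?V z + lo (2 * s) ?V x \<le> 2 * ?V x" by (simp add: numeral_3_eq_3)
    qed
  next
    fix x y assume y: "y \<in> Y" "dist x y < 4 * s"
    show "F y - 6 * L * s \<le> ?V x"
    proof (rule lo_greatest[OF s])
      fix z assume "dist x z < s"
      then have "dist z y + s \<le> 6 * s" using y(2) dist_triangle[of z y x] by (simp add: dist_commute)
      from mult_left_mono[OF this, of L] have "L * (dist z y + s) \<le> 6 * L * s" using L_pos by simp
      with u_ge_near_Y[OF s y(1), of z] show "F y - 6 * L * s \<le> u s z" by linarith
    qed
  qed (use s L_pos in auto)
  moreover have "?V x \<le> u s x" by (rule lo_le_self[OF m s])
  ultimately show ?thesis by (simp add: algebra_simps)
qed

text \<open>
  With \<open>w = u (2 * s)\<close> and \<open>V = lo (2 * s) w\<close>, every \<open>x\<close> away from \<open>Y\<close> has a \<open>t\<close> within \<open>2 * s\<close>, a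
  near-minimum of \<open>w\<close>, such that \<open>V t\<close> and the supremum of \<open>V\<close> over the ball of radius \<open>4 * s\<close>
  about \<open>t\<close> average to at most \<open>V x\<close>. The cones with apex \<open>t\<close> that rise to this supremum in four
  moves are superharmonic on scale \<open>s\<close> except at the apex and the rim, and there another cone is
  lower; so their infimum \<open>W\<close> is superharmonic on scale \<open>s\<close>.
\<close>

lemma u_le_double:
  assumes s: "0 < s" shows "u s x \<le> u (2 * s) x + 12 * L * s"
proof -
  define w where "w = u (2 * s)"
  have s2: "0 < 2 * s" using s by simp
  note m = u_ge[OF s2, folded w_def]
  define V where "V = lo (2 * s) w"
  have mV: "\<forall>x. m \<le> V x" unfolding V_def by (rule lo_ge_m[OF s2 m])
  define bound where "bound = (\<lambda>t M. \<forall>z. dist t z < 4 * s \<longrightarrow> V z \<le> M)"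
  define S where "S = (\<lambda>x. {V t + (M - V t) * real (steps s x t) / 4 | t M. steps s x t \<le> 3 \<and> bound t M})"
  define W where "W = (\<lambda>x. Inf (S x))"
  have bound_ge: "V t \<le> M" if "bound t M" for t M using that s unfolding bound_def by auto
  have ex_bound: "\<exists>M. bound x M" for x
  proof (rule exI, unfold bound_def, intro allI impI)
    fix z assume z: "dist x z < 4 * s"
    have "V z \<le> w z" unfolding V_def by (rule lo_le_self[OF m s2])
    also have "w z \<le> w x + L * (dist x z + 2 * s)" using u_lipschitz[OF s2, of x z] unfolding w_def by simp
    also have "\<dots> \<le> w x + L * (6 * s)" using z L_pos by simp
    finally show "V z \<le> w x + L * (6 * s)" .
  qed
  have S_ge: "V t \<le> V t + (M - V t) * real (steps s x t) / 4" if "bound t M" for x t M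
    using bound_ge[OF that] by simp
  have bdd: "bdd_below (S x)" for x
    unfolding S_def by (rule bdd_belowI[of _ m]) (use S_ge mV order_trans in blast)
  have W_le: "W x \<le> V t + (M - V t) * real (steps s x t) / 4" if "steps s x t \<le> 3" "bound t M" for x t M
    unfolding W_def by (rule cInf_lower[OF _ bdd]) (use that in \<open>auto simp: S_def\<close>)
  have W_le_V: "W x \<le> V x" for x
    using ex_bound[of x] W_le[of x x] by auto
  have W_geI: "c \<le> W x" if "\<And>t M. steps s x t \<le> 3 \<Longrightarrow> bound t M \<Longrightarrow> c \<le> V t + (M - V t) * real (steps s x t) / 4" for c x
    unfolding W_def
  proof (rule cInf_greatest)
    obtain M where "bound x M" using ex_bound by blast
    then have "V x + (M - V x) * real (steps s x x) / 4 \<in> S x" unfolding S_def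
      by (intro CollectI exI[of _ x] exI[of _ M]) simp
    then show "S x \<noteq> {}" by blast
  qed (use that in \<open>auto simp: S_def\<close>)
  have mW: "\<forall>x. m \<le> W x" using S_ge mV by (meson W_geI order_trans)
  have cone_step: "W p + lo s W x \<le> 2 * (V t + (M - V t) * real (steps s x t) / 4)"
    if p: "dist x p < s" and t: "t \<noteq> x" "steps s x t \<le> 3" "bound t M" for x p t M
  proof -
    define N where "N = steps s x t"
    have MV: "0 \<le> (M - V t) / 4" using bound_ge[OF t(3)] by simp
    obtain q where q: "dist x q < s" "Suc (steps s q t) \<le> N" using steps_descend[OF len s] t(1) unfolding N_def by metis
    have "lo s W x \<le> W q" by (rule lo_le[OF mW q(1)])
    also have "\<dots> \<le> V t + (M - V t) * real (steps s q t) / 4" using W_le[of q t M] q t unfolding N_def by simp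
    also have "\<dots> \<le> V t + (M - V t) / 4 * (real N - 1)"
      using mult_left_mono[OF _ MV, of "real (steps s q t)" "real N - 1"] q(2) by simp
    finally have 1: "lo s W x \<le> V t + (M - V t) / 4 * (real N - 1)" .
    have "steps s p t \<le> Suc N" using steps_triangle_1[OF s, of p x t] p unfolding N_def by (simp add: dist_commute)
    have 2: "W p \<le> V t + (M - V t) / 4 * (real N + 1)"
    proof (cases "steps s p t \<le> 3")
      case True
      have "W p \<le> V t + (M - V t) * real (steps s p t) / 4" by (rule W_le[OF True t(3)])
      also have "\<dots> \<le> V t + (M - V t) / 4 * (real N + 1)"
        using mult_left_mono[OF _ MV, of "real (steps s p t)" "real N + 1"] \<open>steps s p t \<le> Suc N\<close> by simp
      finally show ?thesis .
    next
      case False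
      then have N: "N = 3" using \<open>steps s p t \<le> Suc N\<close> t(2) unfolding N_def by simp
      then have "dist p t < 4 * s" using steps_le_iff[OF s, of 4 p t] \<open>steps s p t \<le> Suc N\<close> by simp
      then have "V p \<le> M" using t(3) unfolding bound_def by (simp add: dist_commute)
      moreover have "V t + (M - V t) / 4 * (real N + 1) = M" unfolding N by (simp add: field_simps)
      ultimately show ?thesis using W_le_V[of p] by linarith
    qed
    have "V t + a * (n + 1) + (V t + a * (n - 1)) = 2 * (V t + a * n)" for a n :: real
      by (simp add: algebra_simps)
    from add_mono[OF 2 1, unfolded this] show ?thesis unfolding N_def by simp
  qed
  \<comment> \<open>The 9 collects \<open>3 * s\<close> from \<open>x\<close> to the apex,
    \<open>2 * s\<close> from the apex to a point of its ball, \<open>2 * s\<close> from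
    \<open>x\<close> to \<open>Y\<close>, and the scale \<open>2 * s\<close> of
    \<open>w\<close>.\<close>
  have "u s x \<le> W x + (9 * L * s + L * (2 * s + s))"
  proof (rule u_le_of_superharmonic_away[OF s mW])
    fix x assume far: "\<And>y. y \<in> Y \<Longrightarrow> 2 * s \<le> dist x y"
    show "superharmonic_at s W x"
      unfolding superharmonic_at_def
    proof (intro allI impI)
      fix p assume p: "dist x p < s"
      have at_apex: "(W p + lo s W x) / 2 \<le> V x"
      proof (rule field_le_epsilon)
        fix \<eta> :: real assume \<eta>: "0 < \<eta>"
        obtain t where t: "dist x t < 2 * s" "w t < V x + \<eta>"
          using lo_less[OF s2, of w x "V x + \<eta>"] \<eta> unfolding V_def by auto
        then have "t \<notin> Y" using far[of t] by auto
        then have sh: "superharmonic_at (2 * s) w t" unfolding w_def by (rule u_superharmonic[OF s2])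
        define M where "M = 2 * w t - V t"
        have bound: "bound t M" unfolding bound_def
        proof (intro allI impI)
          fix z assume "dist t z < 4 * s"
          then obtain q where q: "dist t q < 2 * s" "dist q z < 2 * s"
            using length_space_split[OF len, of t z "2 * s" "2 * s"] s by auto
          have "V z \<le> w q" unfolding V_def using lo_le[OF m, of z q "2 * s"] q(2) by (simp add: dist_commute)
          also have "w q \<le> M" using superharmonic_atD[OF sh q(1)] unfolding M_def V_def by simp
          finally show "V z \<le> M" .
        qed
        show "(W p + lo s W x) / 2 \<le> V x + \<eta>"
        proof (cases "t = x")
          case True
          have "W p \<le> M" using W_le_V[of p] bound p s True unfolding bound_def by (smt (verit))
          moreover have "lo s W x \<le> V x" using lo_le_self[OF mW s, of x] W_le_V[of x] by simp
          ultimately show ?thesis using t(2) True unfolding M_def by simp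
        next
          case False
          \<comment> \<open>\<open>x\<close> is at most two of the four moves away from
            \<open>t\<close>, so the cone at \<open>x\<close> is at most
            \<open>(V t + M) / 2\<close>, which is \<open>w t\<close> by the choice of
            \<open>M\<close>.\<close>
          have N: "steps s x t \<le> 2" using steps_le_iff[OF s, of 2 x t] t(1) by simp
          have "W p + lo s W x \<le> 2 * (V t + (M - V t) * real (steps s x t) / 4)"
            by (rule cone_step[OF p False _ bound]) (use N in simp)
          moreover have "(M - V t) * real (steps s x t) \<le> (M - V t) * 2"
            using N bound_ge[OF bound] by (intro mult_left_mono) auto
          ultimately have "W p + lo s W x \<le> V t + M" by argo
          then show ?thesis using t(2) unfolding M_def by simp
        qed
      qed
      have "(W p + lo s W x) / 2 \<le> W x"
      proof (rule W_geI)
        fix t M assume t: "steps s x t \<le> 3" "bound t M"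
        show "(W p + lo s W x) / 2 \<le> V t + (M - V t) * real (steps s x t) / 4"
        proof (cases "t = x")
          case True
          then show ?thesis using at_apex by simp
        next
          case False
          from cone_step[OF p False t] show ?thesis by argo
        qed
      qed
      then show "W p + lo s W x \<le> 2 * W x" by argo
    qed
  next
    fix x y assume y: "y \<in> Y" "dist x y < 2 * s"
    show "F y - 9 * L * s \<le> W x"
    proof (rule W_geI)
      fix t M assume t: "steps s x t \<le> 3" "bound t M"
      have xt: "dist x t < 3 * s" using steps_le_iff[OF s, of 3 x t] t(1) by simp
      have "F y - 9 * L * s \<le> V t"
        unfolding V_def
      proof (rule lo_greatest[OF s2])
        fix z assume z: "dist t z < 2 * s"
        have "dist z y \<le> dist t z + (dist x t + dist x y)"
          by (metis dist_commute dist_triangle add_left_mono order_trans)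
        then have "dist z y + 2 * s \<le> 9 * s" using xt z y(2) by linarith
        from mult_left_mono[OF this, of L] have "L * (dist z y + 2 * s) \<le> 9 * L * s" using L_pos by simp
        with u_ge_near_Y[OF s2 y(1), of z] show "F y - 9 * L * s \<le> w z" unfolding w_def by linarith
      qed
      with S_ge[OF t(2), of x] show "F y - 9 * L * s \<le> V t + (M - V t) * real (steps s x t) / 4" by linarith
    qed
  qed (use s L_pos in auto)
  moreover have "W x \<le> w x" using W_le_V[of x] lo_le_self[OF m s2, of x] unfolding V_def by simp
  ultimately show ?thesis unfolding w_def by (simp add: algebra_simps)
qed

end

section \<open>The continuum limit\<close>

lemma dyadic_limit:
  fixes a :: "nat \<Rightarrow> real"
  assumes "\<And>k. \<bar>a (Suc k) - a k\<bar> \<le> c / 2 ^ Suc k"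
  shows "\<exists>l. \<forall>k. \<bar>a k - l\<bar> \<le> c / 2 ^ k"
proof -
  have "0 \<le> c / 2 ^ Suc 0" using assms[of 0] abs_ge_zero order_trans by blast
  then have c: "0 \<le> c" by simp
  define b where "b = (\<lambda>k. a k - c / 2 ^ k)"
  define d where "d = (\<lambda>k. a k + c / 2 ^ k)"
  have half: "c / 2 ^ k = c / 2 ^ Suc k + c / 2 ^ Suc k" for k by simp
  have "b k \<le> b (Suc k)" for k using assms[of k] half[of k] unfolding b_def by linarith
  then have b: "incseq b" by (rule incseq_SucI)
  have "d (Suc k) \<le> d k" for k using assms[of k] half[of k] unfolding d_def by linarith
  then have d: "decseq d" by (rule decseq_SucI)
  have bd: "b i \<le> d j" for i j
  proof -
    have "b i \<le> b (max i j)" using b by (simp add: incseqD)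
    also have "\<dots> \<le> d (max i j)" using c by (simp add: b_def d_def)
    also have "\<dots> \<le> d j" using d by (simp add: decseqD)
    finally show ?thesis .
  qed
  define l where "l = (SUP i. b i)"
  have "bdd_above (range b)" by (rule bdd_aboveI[of _ "d 0"]) (use bd in auto)
  then have "b k \<le> l" for k unfolding l_def by (intro cSUP_upper) auto
  moreover have "l \<le> d k" for k unfolding l_def using bd by (intro cSUP_least) auto
  ultimately show ?thesis unfolding b_def d_def by (intro exI[of _ l] allI) (smt (verit))
qed

context tug
begin

text \<open>
  Since \<open>lo (2 * \<rho>) U = lo \<rho> (lo \<rho> U)\<close>, this says that \<open>lo \<rho> U\<close> is superharmonic on scale \<open>\<rho>\<close>
  away from \<open>Y\<close>, for every \<open>\<rho>\<close>. The function \<open>U\<close> itself need not be.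
\<close>

definition superharmonic_on_scales :: "('a \<Rightarrow> real) \<Rightarrow> bool" where
  "superharmonic_on_scales U \<longleftrightarrow> (\<forall>\<rho>>0. \<forall>x z. (\<forall>y\<in>Y. 4 * \<rho> \<le> dist x y) \<longrightarrow> dist x z < \<rho> \<longrightarrow>
     lo \<rho> U z + lo (2 * \<rho>) U x \<le> 2 * lo \<rho> U x)"

text \<open>Leastness of \<open>u\<close> in the form that survives the limit. It is applied to the
  limit and to arbitrary absolutely minimal extensions, whose Lipschitz bound \<open>L'\<close> is
  unrelated to \<open>L\<close>.\<close>

lemma u_le_of_superharmonic_on_scales:
  assumes U: "superharmonic_on_scales U" and m: "\<forall>x. m \<le> U x" and L': "0 \<le> L'"
    and F: "\<And>x y. y \<in> Y \<Longrightarrow> F y - L' * dist x y \<le> U x" and \<rho>: "0 < \<rho>"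
  shows "u \<rho> x \<le> U x + 5 * (L' + L) * \<rho>"
proof -
  have "u \<rho> x \<le> lo \<rho> U x + (5 * L' * \<rho> + L * (4 * \<rho> + \<rho>))"
  proof (rule u_le_of_superharmonic_away[OF \<rho> lo_ge_m[OF \<rho> m]])
    fix x assume "\<And>y. y \<in> Y \<Longrightarrow> 4 * \<rho> \<le> dist x y"
    then have "lo \<rho> U z + lo (2 * \<rho>) U x \<le> 2 * lo \<rho> U x" if "dist x z < \<rho>" for z
      using U \<rho> that unfolding superharmonic_on_scales_def by blast
    moreover have "lo \<rho> (lo \<rho> U) x = lo (2 * \<rho>) U x" using lo_lo[OF len m \<rho> \<rho>, of x] by (metis mult_2)
    ultimately show "superharmonic_at \<rho> (lo \<rho> U) x" by (simp add: superharmonic_at_def)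
  next
    fix x y assume y: "y \<in> Y" "dist x y < 4 * \<rho>"
    show "F y - 5 * L' * \<rho> \<le> lo \<rho> U x"
    proof (rule lo_greatest[OF \<rho>])
      fix z assume "dist x z < \<rho>"
      then have "dist z y \<le> 5 * \<rho>" using y(2) dist_triangle[of z y x] by (simp add: dist_commute)
      from mult_left_mono[OF this L'] show "F y - 5 * L' * \<rho> \<le> U z" using F[OF y(1), of z] by simp
    qed
  qed (use \<rho> L' in auto)
  moreover have "lo \<rho> U x \<le> U x" by (rule lo_le_self[OF m \<rho>])
  ultimately show ?thesis by (simp add: algebra_simps)
qed

lemma lo_radius:
  fixes U :: "'a \<Rightarrow> real"
  assumes m: "\<forall>x. m \<le> U x" and lip: "\<And>x z. \<bar>U x - U z\<bar> \<le> L * dist x z"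
    and "0 < a" "0 < c" "b < a + c" "0 < b"
  shows "lo a U x \<le> lo b U x + L * c"
proof -
  have "lo a U x - L * c \<le> lo b U x"
  proof (rule lo_greatest[OF \<open>0 < b\<close>])
    fix y assume "dist x y < b"
    then have "dist x y < a + c" using \<open>b < a + c\<close> by simp
    from length_space_split[OF len this \<open>0 < a\<close> \<open>0 < c\<close>]
    obtain p where p: "dist x p < a" "dist p y < c" by blast
    have "L * dist p y \<le> L * c" using p(2) L_pos by simp
    then show "lo a U x - L * c \<le> U y" using lo_le[OF m p(1)] lip[of p y] by linarith
  qed
  then show ?thesis by simp
qed

section \<open>Uniform limits along some sequence of scales tending to 0\<close>

context
  fixes U :: "'a \<Rightarrow> real" and C :: real
  assumes C: "0 \<le> C" and approx: "\<And>e. 0 < e \<Longrightarrow> \<exists>s>0. s \<le> e \<and> (\<forall>x. \<bar>u s x - U x\<bar> \<le> C * s)"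
begin

lemma limit_approx:
  assumes "0 < e" "0 \<le> D" obtains s where "0 < s" "s \<le> e" "\<And>x. \<bar>u s x - U x\<bar> \<le> C * s" "D * s \<le> e"
proof -
  obtain s where s: "0 < s" "s \<le> min e (e / (D + 1))" "\<forall>x. \<bar>u s x - U x\<bar> \<le> C * s"
    using approx[of "min e (e / (D + 1))"] assms by (auto simp: add_nonneg_pos)
  have "s * (D + 1) \<le> e" using s(2) assms(2) by (simp add: pos_le_divide_eq add_nonneg_pos)
  then have "D * s \<le> e" using s(1) by (simp add: algebra_simps)
  then show thesis using that[of s] s by auto
qed

lemma limit_ge_m: "\<forall>x. m \<le> U x"
proof
  fix x show "m \<le> U x"
  proof (rule field_le_epsilon)
    fix e :: real assume "0 < e"
    then obtain s where s: "0 < s" "\<And>x. \<bar>u s x - U x\<bar> \<le> C * s" "C * s \<le> e" using limit_approx[OF _ C] by blast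
    moreover have "m \<le> u s x" using u_ge[OF s(1)] by blast
    ultimately show "m \<le> U x + e" using s(2)[of x] by linarith
  qed
qed

lemma limit_lipschitz: "\<bar>U x - U z\<bar> \<le> L * dist x z"
proof (rule field_le_epsilon)
  fix e :: real assume e: "0 < e"
  have "0 \<le> 2 * C + L" using C L_pos by simp
  from limit_approx[OF e this]
  obtain s where s: "0 < s" "\<And>x. \<bar>u s x - U x\<bar> \<le> C * s" "(2 * C + L) * s \<le> e" by blast
  have "L * (dist x z + s) = L * dist x z + L * s" by (simp add: algebra_simps)
  moreover have "2 * (C * s) + L * s \<le> e" using s(3) by (simp add: algebra_simps)
  ultimately show "\<bar>U x - U z\<bar> \<le> L * dist x z + e"
    using u_lipschitz[OF s(1), of x z] s(2)[of x] s(2)[of z] by linarith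
qed

lemma limit_eq_F: assumes "y \<in> Y" shows "U y = F y"
proof -
  have "\<bar>F y - U y\<bar> \<le> 0"
  proof (rule field_le_epsilon)
    fix e :: real assume "0 < e"
    then obtain s where s: "0 < s" "\<And>x. \<bar>u s x - U x\<bar> \<le> C * s" "C * s \<le> e" using limit_approx[OF _ C] by blast
    then show "\<bar>F y - U y\<bar> \<le> 0 + e" using s(2)[of y] u_eq_F[OF s(1) assms] by simp
  qed
  then show ?thesis by simp
qed

lemma limit_superharmonic_on_scales: "superharmonic_on_scales U"
  unfolding superharmonic_on_scales_def
proof (intro allI impI)
  fix \<rho> :: real and x z :: 'a
  assume \<rho>: "0 < \<rho>" and far: "\<forall>y\<in>Y. 4 * \<rho> \<le> dist x y" and z: "dist x z < \<rho>"
  show "lo \<rho> U z + lo (2 * \<rho>) U x \<le> 2 * lo \<rho> U x"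
  proof (rule field_le_epsilon)
    fix e :: real assume e: "0 < e"
    \<comment> \<open>Each of the four values of \<open>lo\<close>, counted with multiplicity, costs
      \<open>C * s\<close>; adjusting their radii costs \<open>L * s\<close>,
      \<open>2 * L * s\<close> and twice \<open>L * s\<close>.\<close>
    have "0 < min e \<rho>" "0 \<le> 4 * C + 5 * L" using e \<rho> C L_pos by auto
    from limit_approx[OF this]
    obtain s where s: "0 < s" "s \<le> min e \<rho>" "\<And>x. \<bar>u s x - U x\<bar> \<le> C * s" "(4 * C + 5 * L) * s \<le> min e \<rho>"
      by blast
    \<comment> \<open>Now \<open>k * s \<le> \<rho> < Suc k * s\<close>, so \<rho> and
      \<open>2 * \<rho>\<close> can be exchanged for multiples of \<open>s\<close> at the price of
      the Lipschitz bound.\<close>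
    define k where "k = nat \<lfloor>\<rho> / s\<rfloor>"
    have "real k \<le> \<rho> / s" "\<rho> / s < real k + 1" "1 \<le> \<rho> / s" using s(1,2) \<rho> unfolding k_def by (auto simp: of_nat_floor)
    then have ks: "real k * s \<le> \<rho>" "\<rho> < real (Suc k) * s" and "s \<le> \<rho>"
      using s(1) by (auto simp: pos_le_divide_eq pos_divide_less_eq add.commute)
    then have k: "0 < k" by (cases k) auto
    obtain j where j: "k = Suc j" using k by (cases k) auto
    have ks0: "0 < real k * s" "0 < real (2 * k + 1) * s" using k s(1) by simp_all
    have "(lo s ^^ k) (u s) z + (lo s ^^ (2 * k + 1)) (u s) x \<le> 2 * (lo s ^^ k) (u s) x"
    proof (rule superharmonic_scale_up[OF len s(1) u_ge[OF s(1)]])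
      fix y assume "dist x y < real (2 * Suc k) * s"
      also have "\<dots> = 2 * (real k * s) + 2 * s" by (simp add: algebra_simps)
      also have "\<dots> \<le> 4 * \<rho>" using ks(1) s(2) by simp
      finally have "y \<notin> Y" using far by auto
      then show "superharmonic_at s (u s) y" by (rule u_superharmonic[OF s(1)])
    qed (use z ks in simp)
    then have main: "lo (real k * s) (u s) z + lo (real (2 * k + 1) * s) (u s) x \<le> 2 * lo (real k * s) (u s) x"
      using lo_iterate[OF len s(1) u_ge[OF s(1)], of j] lo_iterate[OF len s(1) u_ge[OF s(1)], of "2 * k"]
      unfolding j by simp
    have U_le: "U y \<le> u s y + C * s" and u_le: "u s y \<le> U y + C * s" for y using s(3)[of y] by linarith+
    have "lo \<rho> U z \<le> lo (real k * s) U z + L * s"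
      using ks s(1) ks0 \<rho> by (intro lo_radius[OF limit_ge_m limit_lipschitz]) auto
    also have "\<dots> \<le> lo (real k * s) (u s) z + C * s + L * s"
      using lo_le_lo_add[OF ks0(1) limit_ge_m U_le, of z] by simp
    finally have 1: "lo \<rho> U z \<le> lo (real k * s) (u s) z + C * s + L * s" .
    have "lo (2 * \<rho>) U x \<le> lo (real (2 * k + 1) * s) U x + L * (2 * s)"
      using ks s(1) ks0 \<rho> by (intro lo_radius[OF limit_ge_m limit_lipschitz]) (auto simp: algebra_simps)
    also have "\<dots> \<le> lo (real (2 * k + 1) * s) (u s) x + C * s + L * (2 * s)"
      using lo_le_lo_add[OF ks0(2) limit_ge_m U_le, of x] by simp
    finally have 2: "lo (2 * \<rho>) U x \<le> lo (real (2 * k + 1) * s) (u s) x + C * s + 2 * (L * s)" by simp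
    have "lo (real k * s) (u s) x \<le> lo (real k * s) U x + C * s"
      by (rule lo_le_lo_add[OF ks0(1) u_ge[OF s(1)] u_le])
    also have "\<dots> \<le> lo \<rho> U x + L * s + C * s"
      using ks s(1) ks0 \<rho> lo_radius[OF limit_ge_m limit_lipschitz, of "real k * s" s \<rho> x] by (simp add: algebra_simps)
    finally have 3: "lo (real k * s) (u s) x \<le> lo \<rho> U x + L * s + C * s" .
    have "4 * (C * s) + 5 * (L * s) \<le> e" using s(4) by (simp add: algebra_simps)
    then show "lo \<rho> U z + lo (2 * \<rho>) U x \<le> 2 * lo \<rho> U x + e"
      using main 1 2 3 by linarith
  qed
qed

lemma u_le_limit: "0 < \<rho> \<Longrightarrow> u \<rho> x \<le> U x + 10 * L * \<rho>"
proof -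
  assume \<rho>: "0 < \<rho>"
  have "F y - L * dist x y \<le> U x" if "y \<in> Y" for x y
    using limit_lipschitz[of x y] limit_eq_F[OF that] by linarith
  from u_le_of_superharmonic_on_scales[OF limit_superharmonic_on_scales limit_ge_m less_imp_le[OF L_pos] this \<rho>, of x]
  show ?thesis by (simp add: mult_2[of L, symmetric])
qed

end

text \<open>
  The limits along \<open>r / 2 ^ k\<close> could depend on \<open>r\<close>. Each of them is superharmonic on all scales, hence
  dominates \<open>u \<rho>\<close> up to \<open>O(\<rho>)\<close> for every \<open>\<rho>\<close>, and therefore dominates all the others.
\<close>

theorem u_converges: "\<exists>U. \<forall>s>0. \<forall>x. \<bar>u s x - U x\<bar> \<le> 12 * L * s"
proof -
  have "\<exists>V. \<forall>k x. \<bar>u (r / 2 ^ k) x - V x\<bar> \<le> 12 * L * r / 2 ^ k" if r: "0 < r" for r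
  proof -
    have "\<exists>l. \<forall>k. \<bar>u (r / 2 ^ k) x - l\<bar> \<le> 12 * L * r / 2 ^ k" for x
    proof (rule dyadic_limit)
      fix k
      have s: "0 < r / 2 ^ Suc k" and d: "2 * (r / 2 ^ Suc k) = r / 2 ^ k" using r by simp_all
      show "\<bar>u (r / 2 ^ Suc k) x - u (r / 2 ^ k) x\<bar> \<le> 12 * L * r / 2 ^ Suc k"
        using u_double_le[OF s, of x] u_le_double[OF s, of x] unfolding d by simp
    qed
    then show ?thesis by metis
  qed
  then obtain V where V: "\<And>r k x. 0 < r \<Longrightarrow> \<bar>u (r / 2 ^ k) x - V r x\<bar> \<le> 12 * L * r / 2 ^ k" by metis
  have twelve_L_nonneg: "0 \<le> 12 * L" using L_pos by simp
  have approx: "\<exists>s>0. s \<le> e \<and> (\<forall>x. \<bar>u s x - V r x\<bar> \<le> 12 * L * s)" if r: "0 < r" and e: "0 < e" for r e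
  proof -
    obtain k where k: "inverse 2 ^ k < e / r" using real_arch_pow_inv[of "e / r" "inverse 2"] e r by auto
    have "r / 2 ^ k \<le> e" using k r by (simp add: pos_less_divide_eq power_inverse field_simps)
    then show ?thesis using V[OF r, of k] r by (intro exI[of _ "r / 2 ^ k"]) simp
  qed
  have V_le: "V r x \<le> V r' x" if "0 < r" "0 < r'" for r r' x
  proof (rule field_le_epsilon)
    fix e :: real assume e: "0 < e"
    have "0 < e / (22 * L)" using e L_pos by simp
    then obtain s where s: "0 < s" "s \<le> e / (22 * L)" "\<forall>x. \<bar>u s x - V r x\<bar> \<le> 12 * L * s"
      using approx[OF \<open>0 < r\<close>] by metis
    have "u s x \<le> V r' x + 10 * L * s"
      by (rule u_le_limit[OF twelve_L_nonneg approx[OF \<open>0 < r'\<close>] s(1)])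
    moreover have "22 * (L * s) \<le> e" using s(2) L_pos by (simp add: pos_le_divide_eq algebra_simps)
    ultimately show "V r x \<le> V r' x + e" using s(3)[rule_format, of x] by argo
  qed
  have "\<bar>u s x - V 1 x\<bar> \<le> 12 * L * s" if s: "0 < s" for s x
  proof -
    have "V s x = V 1 x" using V_le[OF s, of 1 x] V_le[OF _ s, of 1 x] by simp
    then show ?thesis using V[OF s, of 0 x] by simp
  qed
  then show ?thesis by blast
qed

definition U :: "'a \<Rightarrow> real" where
  "U = (SOME U. \<forall>s>0. \<forall>x. \<bar>u s x - U x\<bar> \<le> 12 * L * s)"

lemma u_near_U: "0 < s \<Longrightarrow> \<bar>u s x - U x\<bar> \<le> 12 * L * s"
  using someI_ex[OF u_converges] unfolding U_def by blast

lemma U_approx: "0 < e \<Longrightarrow> \<exists>s>0. s \<le> e \<and> (\<forall>x. \<bar>u s x - U x\<bar> \<le> 12 * L * s)"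
  using u_near_U by blast

lemma twelve_L_nonneg: "0 \<le> 12 * L" using L_pos by simp

lemma U_ge_m: "\<forall>x. m \<le> U x"
  by (rule limit_ge_m[OF twelve_L_nonneg U_approx])

lemma U_lipschitz: "\<bar>U x - U z\<bar> \<le> L * dist x z"
  by (rule limit_lipschitz[OF twelve_L_nonneg U_approx])

lemma U_eq_F: "y \<in> Y \<Longrightarrow> U y = F y"
  by (rule limit_eq_F[OF twelve_L_nonneg U_approx])

lemma is_continuum_value_U: "is_continuum_value Y F U"
  unfolding is_continuum_value_def
proof (intro conjI allI)
  have pos: "\<forall>\<^sub>F s in at_right (0::real). 0 < s" by (rule eventually_at_right_less)
  then show "\<forall>\<^sub>F s in at_right 0. value_I Y F s = value_II Y F s"
    by eventually_elim (simp add: game_value fun_eq_iff)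
  fix x
  have "((\<lambda>s. u s x) \<longlongrightarrow> U x) (at_right 0)"
  proof (rule LIM_zero_cancel, rule Lim_null_comparison)
    show "\<forall>\<^sub>F s in at_right 0. norm (u s x - U x) \<le> 12 * L * s"
      using pos by eventually_elim (simp add: u_near_U)
  qed (auto intro!: tendsto_eq_intros)
  then show "((\<lambda>s. value_I Y F s x) \<longlongrightarrow> ereal (U x)) (at_right 0)"
    using pos by (intro Lim_transform_eventually[OF tendsto_ereal]) (auto elim: eventually_mono simp: game_value)
qed

end

section \<open>Absolutely minimal extensions\<close>

lemma Lip_le_iff:
  assumes "0 \<le> K"
  shows "Lip W f \<le> ennreal K \<longleftrightarrow> (\<forall>x\<in>W. \<forall>y\<in>W. \<bar>f y - f x\<bar> \<le> K * dist x y)"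
proof -
  have "ennreal (\<bar>f y - f x\<bar> / dist x y) \<le> ennreal K \<longleftrightarrow> \<bar>f y - f x\<bar> \<le> K * dist x y" if "x \<noteq> y" for x y
    using that assms by (simp add: ennreal_le_iff pos_divide_le_eq)
  then show ?thesis unfolding Lip_def SUP_le_iff
    by (fastforce simp: case_prod_beta)
qed

lemma frontier_Diff_singleton:
  fixes V :: "'a::metric_space set"
  shows "frontier (V - {y}) \<subseteq> insert y (frontier V)"
proof -
  have "frontier (V \<inter> - {y}) \<subseteq> frontier V \<union> frontier (- {y})" by (rule frontier_Int_subset)
  also have "frontier (- {y}) \<subseteq> {y}" by (simp add: frontier_complement frontier_subset_closed)
  finally show ?thesis by (auto simp: Diff_eq)
qed

lemma lipschitz_bound_closure:
  fixes f :: "'a::metric_space \<Rightarrow> real"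
  assumes cont: "continuous_on UNIV f" and le: "\<forall>x\<in>V. \<forall>y\<in>V. \<bar>f y - f x\<bar> \<le> K * dist x y"
    and "x \<in> closure V" "y \<in> closure V"
  shows "\<bar>f y - f x\<bar> \<le> K * dist x y"
proof -
  obtain a b where a: "\<And>n. a n \<in> V" "a \<longlonglongrightarrow> x" and b: "\<And>n. b n \<in> V" "b \<longlonglongrightarrow> y"
    using assms(3,4) unfolding closure_sequential by blast
  have f: "(\<lambda>n. f (c n)) \<longlonglongrightarrow> f z" if "c \<longlonglongrightarrow> z" for c z
    using continuous_on_tendsto_compose[OF cont that] by simp
  show ?thesis
  proof (rule LIMSEQ_le)
    show "(\<lambda>n. \<bar>f (b n) - f (a n)\<bar>) \<longlonglongrightarrow> \<bar>f y - f x\<bar>" by (intro tendsto_intros f a b)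
    show "(\<lambda>n. K * dist (a n) (b n)) \<longlonglongrightarrow> K * dist x y" by (intro tendsto_intros a b)
  qed (use le a b in auto)
qed

lemma lipschitz_bound_continuous:
  fixes f :: "'a::metric_space \<Rightarrow> real"
  assumes "\<And>x y. \<bar>f y - f x\<bar> \<le> K * dist x y"
  shows "continuous_on UNIV f"
proof (rule lipschitz_on_continuous_on)
  show "(max K 0)-lipschitz_on UNIV f"
  proof (rule lipschitz_onI)
    fix x y
    have "\<bar>f y - f x\<bar> \<le> max K 0 * dist x y"
      using assms[of y x] by (rule order_trans) (simp add: mult_right_mono)
    then show "dist (f x) (f y) \<le> max K 0 * dist x y" by (simp add: dist_real_def abs_minus_commute)
  qed simp
qed

lemma length_space_near_frontier:
  fixes x z :: "'a::metric_space"
  assumes len: "length_space TYPE('a)" and V: "x \<in> V" "z \<notin> V" "dist x z < s"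
  obtains c where "c \<in> frontier V" "dist x c < s" "dist c z < s"
proof -
  obtain c where "c \<in> frontier V" "dist x c + dist c z < s"
    using length_space_cross_frontier[OF len V(1,2,3)] by blast
  then show thesis using that[of c] zero_le_dist[of x c] zero_le_dist[of c z] by linarith
qed

context tug
begin

text \<open>Leastness gives the bound from above: the minimum of \<open>u s\<close> and a cone in
  \<open>V\<close> is again a supersolution, provided that no move leaves \<open>V\<close> from a
  point where the cone is smaller.\<close>

lemma U_le_cone:
  assumes V: "open V" "V \<inter> Y = {}" and b: "b \<notin> V" and K: "0 < K"
    and bdry: "\<And>c. c \<in> frontier V \<Longrightarrow> U c \<le> U b + K * dist c b" and x: "x \<in> V"
  shows "U x \<le> U b + K * dist x b"
proof (rule field_le_epsilon)
  fix e :: real assume e: "0 < e"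
  define s where "s = e / (25 * L + 2 * K)"
  have D: "0 < 25 * L + 2 * K" using L_pos K by simp
  then have s_pos: "0 < s" and "(25 * L + 2 * K) * s = e" using e by (simp_all add: s_def)
  then have "25 * (L * s) + 2 * (K * s) = e" by (simp add: algebra_simps)
  note s = s_pos this
  \<comment> \<open>Raised so that it dominates \<open>u s\<close> wherever a move can leave
    \<open>V\<close>: \<open>12 * L * s\<close> from \<open>U\<close> to \<open>u s\<close>, then
    \<open>L * s\<close> and \<open>K * s\<close> to reach the frontier. Passing back to
    \<open>U\<close> and to \<open>dist\<close> adds \<open>12 * L * s\<close> and
    \<open>K * s\<close>, whence \<open>25 * L + 2 * K\<close>.\<close>
  define cone where "cone = (\<lambda>x. (U b + (13 * (L * s) + K * s)) + K * (s * real (steps s x b)))"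
  define H where "H = (\<lambda>y. if y \<in> V then min (u s y) (cone y) else u s y)"
  note m = u_ge[OF s(1)]
  have Ls: "0 \<le> L * s" "0 \<le> K * s" using L_pos K s(1) by auto
  have "m \<le> U b" using U_ge_m by blast
  moreover have "0 \<le> K * (s * real (steps s y b))" for y using K s(1) by simp
  ultimately have "m \<le> cone y" for y using Ls unfolding cone_def by (smt (verit))
  then have mH: "\<forall>x. m \<le> H x" using m by (simp add: H_def)
  have inside: "z \<in> V" if y: "y \<in> V" "cone y < u s y" and z: "dist y z < s" for y z
  proof (rule ccontr)
    assume "z \<notin> V"
    then obtain c where c: "c \<in> frontier V" "dist y c < s" using length_space_near_frontier[OF len y(1) _ z] by blast
    have "u s y \<le> U y + 12 * (L * s)" using u_near_U[OF s(1), of y] by simp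
    also have "U y \<le> U c + L * s"
      using U_lipschitz[of y c] mult_left_mono[OF less_imp_le[OF c(2)] less_imp_le[OF L_pos]] by linarith
    also have "U c \<le> U b + K * dist c b" by (rule bdry[OF c(1)])
    also have "dist c b \<le> s * real (steps s y b) + s"
      using dist_triangle[of c b y] c(2) dist_le_steps[OF s(1), of y b] by (simp add: dist_commute)
    finally have "u s y \<le> cone y" using K unfolding cone_def by (simp add: algebra_simps)
    then show False using y(2) by simp
  qed
  have "superharmonic_at s H y" if y: "y \<notin> Y" for y
  proof (cases "H y = u s y")
    case True
    show ?thesis
      by (rule superharmonic_at_min[OF s(1) mH u_superharmonic[OF s(1) y] True]) (simp add: H_def)
  next
    case False
    then have yV: "y \<in> V" "cone y < u s y" "H y = cone y" by (auto simp: H_def min_def split: if_splits)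
    then have "y \<noteq> b" using b by blast
    then have cone: "superharmonic_at s cone y"
      unfolding cone_def using K by (intro superharmonic_at_cone[OF len s(1)]) auto
    show ?thesis
    proof (rule superharmonic_at_min[OF s(1) mH cone yV(3)])
      fix z assume "dist y z < s"
      then show "H z \<le> cone z" using inside[OF yV(1,2)] by (simp add: H_def)
    qed
  qed
  moreover have "F y \<le> H y" if "y \<in> Y" for y
    using that V(2) u_eq_F[OF s(1) that] by (auto simp: H_def)
  ultimately have "H \<in> supersolutions s" using mH by (simp add: supersolutions_def)
  then have "u s x \<le> cone x" using u_le[of H s x] x by (simp add: H_def)
  moreover have "K * (s * real (steps s x b)) \<le> K * dist x b + K * s"
    using mult_left_mono[OF steps_le_dist[OF s(1), of x b] less_imp_le[OF K]] by (simp add: distrib_left)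
  moreover have "U x \<le> u s x + 12 * (L * s)" using u_near_U[OF s(1), of x] by simp
  ultimately show "U x \<le> U b + K * dist x b + e" using s(2) unfolding cone_def by linarith
qed

text \<open>Superharmonicity gives the bound from below, by \<open>cone_below\<close> with the
  complement of \<open>V\<close> as \<open>A\<close>. The constants arise as in the bound from
  above.\<close>

lemma U_ge_cone:
  assumes V: "V \<inter> Y = {}" and b: "b \<notin> V" and K: "0 < K"
    and bdry: "\<And>c. c \<in> frontier V \<Longrightarrow> U b - K * dist c b \<le> U c" and x: "x \<in> V"
  shows "U b - K * dist x b \<le> U x"
proof (rule field_le_epsilon)
  fix e :: real assume e: "0 < e"
  define s where "s = e / (25 * L + 2 * K)"
  have D: "0 < 25 * L + 2 * K" using L_pos K by simp
  then have s_pos: "0 < s" and "(25 * L + 2 * K) * s = e" using e by (simp_all add: s_def)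
  then have "25 * (L * s) + 2 * (K * s) = e" by (simp add: algebra_simps)
  note s = s_pos this
  have "(U b - (13 * (L * s) + K * s)) - K * (s * real (steps s x b)) \<le> u s x"
  proof (rule cone_below[OF len s(1) K u_ge[OF s(1)], where A="- V"])
    fix a z assume "a \<in> - V" "z \<notin> - V" "dist a z < s"
    then obtain c where c: "c \<in> frontier V" "dist c a < s"
      using length_space_near_frontier[OF len, of z V a s] by (auto simp: dist_commute)
    have "K * dist c b \<le> K * (s * real (steps s a b) + s)"
      using dist_triangle[of c b a] c(2) dist_le_steps[OF s(1), of a b] K by (intro mult_left_mono) auto
    moreover have "U c \<le> U a + L * s"
      using U_lipschitz[of c a] mult_left_mono[OF less_imp_le[OF c(2)] less_imp_le[OF L_pos]] by linarith
    moreover have "U a \<le> u s a + 12 * (L * s)" using u_near_U[OF s(1), of a] by simp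
    ultimately show "(U b - (13 * (L * s) + K * s)) - K * (s * real (steps s a b)) \<le> u s a"
      using bdry[OF c(1)] unfolding distrib_left by linarith
  next
    fix y assume "y \<notin> - V"
    then show "superharmonic_at s (u s) y" using V by (intro u_superharmonic[OF s(1)]) auto
  qed (use b x in auto)
  moreover have "K * (s * real (steps s x b)) \<le> K * dist x b + K * s"
    using mult_left_mono[OF steps_le_dist[OF s(1), of x b] less_imp_le[OF K]] by (simp add: distrib_left)
  moreover have "u s x \<le> U x + 12 * (L * s)" using u_near_U[OF s(1), of x] by simp
  ultimately show "U b - K * dist x b \<le> U x + e" using s(2) by linarith
qed

text \<open>Two rounds of cone comparison: apexes on the frontier relate \<open>V\<close> to its
  frontier, and then the apex \<open>y\<close> is used on \<open>V - {y}\<close>, whose frontier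
  adds at most \<open>y\<close>.\<close>

lemma Lip_U_le:
  assumes V: "open V" "V \<inter> Y = {}" and K: "0 < K"
    and fr: "\<forall>x\<in>frontier V. \<forall>y\<in>frontier V. \<bar>U y - U x\<bar> \<le> K * dist x y"
    and xy: "x \<in> V" "y \<in> V"
  shows "U x \<le> U y + K * dist x y"
proof (cases "x = y")
  case False
  have to_frontier: "\<bar>U z - U b\<bar> \<le> K * dist z b" if z: "z \<in> V" and b: "b \<in> frontier V" for z b
  proof -
    have bV: "b \<notin> V" using b V(1) by (simp add: frontier_def interior_open)
    have "U c \<le> U b + K * dist c b" "U b - K * dist c b \<le> U c" if "c \<in> frontier V" for c
      using fr b that by (force simp: abs_le_iff dist_commute)+
    then show ?thesis
      using U_le_cone[OF V bV K _ z] U_ge_cone[OF V(2) bV K _ z] by (simp add: abs_le_iff)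
  qed
  show ?thesis
  proof (rule U_le_cone)
    show "open (V - {y})" using V(1) by (simp add: open_delete)
    fix c assume "c \<in> frontier (V - {y})"
    then have "c \<in> insert y (frontier V)" using frontier_Diff_singleton by blast
    then show "U c \<le> U y + K * dist c y"
      using to_frontier[OF xy(2), of c] by (auto simp: abs_le_iff dist_commute)
  qed (use V(2) xy False K in auto)
qed simp

lemma U_continuous: "continuous_on UNIV U"
  by (rule lipschitz_bound_continuous[of _ L]) (use U_lipschitz in \<open>simp add: dist_commute abs_minus_commute\<close>)

theorem AM_extension_U: "AM_extension Y F U"
  unfolding AM_extension_def
proof (intro conjI allI impI ballI)
  show "U y = F y" if "y \<in> Y" for y by (rule U_eq_F[OF that])
  have "Lip UNIV U \<le> ennreal L"
    using Lip_le_iff[of L UNIV U] L_pos U_lipschitz by (simp add: abs_minus_commute)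
  then show "Lip UNIV U < \<infinity>" by (simp add: order_le_less_trans)
  fix V :: "'a set" assume V: "open V" "V \<subseteq> UNIV - Y"
  show "Lip V U = Lip (frontier V) U"
  proof (rule antisym)
    show "Lip V U \<le> Lip (frontier V) U"
    proof (rule ennreal_le_epsilon)
      \<comment> \<open>Cone comparison needs a positive slope while \<open>k\<close> may be 0,
        hence the excess \<open>e\<close>.\<close>
      fix e :: real assume fin: "Lip (frontier V) U < \<top>" and e: "0 < e"
      obtain k where k: "0 \<le> k" "Lip (frontier V) U = ennreal k" using fin by (cases "Lip (frontier V) U") auto
      then have le: "\<forall>x\<in>frontier V. \<forall>y\<in>frontier V. \<bar>U y - U x\<bar> \<le> k * dist x y"
        using Lip_le_iff[of k "frontier V" U] by simp
      have "\<forall>x\<in>frontier V. \<forall>y\<in>frontier V. \<bar>U y - U x\<bar> \<le> (k + e) * dist x y"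
        using le e by (meson add_increasing2 less_imp_le mult_right_mono order_refl order_trans zero_le_dist)
      then have "U x \<le> U y + (k + e) * dist x y" if "x \<in> V" "y \<in> V" for x y
        using Lip_U_le[of V "k + e" x y] V k(1) e that by auto
      then have "\<forall>x\<in>V. \<forall>y\<in>V. \<bar>U y - U x\<bar> \<le> (k + e) * dist x y"
        by (fastforce simp: abs_le_iff dist_commute)
      then have "Lip V U \<le> ennreal (k + e)" using Lip_le_iff[of "k + e" V U] k(1) e by simp
      then show "Lip V U \<le> Lip (frontier V) U + ennreal e" using k e by (simp add: ennreal_plus)
    qed
    show "Lip (frontier V) U \<le> Lip V U"
    proof (cases "Lip V U")
      case (real k)
      then have "\<forall>x\<in>V. \<forall>y\<in>V. \<bar>U y - U x\<bar> \<le> k * dist x y" using Lip_le_iff[of k V U] by simp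
      then have "\<forall>x\<in>frontier V. \<forall>y\<in>frontier V. \<bar>U y - U x\<bar> \<le> k * dist x y"
        using lipschitz_bound_closure[OF U_continuous] by (auto simp: frontier_def)
      then show ?thesis using real Lip_le_iff[of k "frontier V" U] by simp
    qed simp
  qed
qed

end

section \<open>Uniqueness for bounded boundary data\<close>

lemma AM_extension_lipschitz:
  assumes "AM_extension Y F v"
  obtains K where "0 \<le> K" "\<And>x y. \<bar>v y - v x\<bar> \<le> K * dist x y"
proof -
  have "Lip UNIV v < \<top>" using assms by (simp add: AM_extension_def)
  then obtain K where K: "0 \<le> K" "Lip UNIV v = ennreal K" by (cases "Lip UNIV v") auto
  then have "\<bar>v y - v x\<bar> \<le> K * dist x y" for x y using Lip_le_iff[of K UNIV v] by simp
  with K(1) that show thesis by blast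
qed

lemma AM_extension_continuous:
  assumes "AM_extension Y F v" shows "continuous_on UNIV v"
  using AM_extension_lipschitz[OF assms] lipschitz_bound_continuous by metis

lemma AM_extension_closure:
  assumes v: "AM_extension Y F v" and V: "open V" "V \<inter> Y = {}" and K: "0 \<le> K"
    and fr: "\<And>x y. x \<in> frontier V \<Longrightarrow> y \<in> frontier V \<Longrightarrow> \<bar>v y - v x\<bar> \<le> K * dist x y"
    and xy: "x \<in> closure V" "y \<in> closure V"
  shows "\<bar>v y - v x\<bar> \<le> K * dist x y"
proof -
  have "Lip V v = Lip (frontier V) v" using v V by (auto simp: AM_extension_def)
  also have "\<dots> \<le> ennreal K" using Lip_le_iff[OF K] fr by blast
  finally have "\<forall>x\<in>V. \<forall>y\<in>V. \<bar>v y - v x\<bar> \<le> K * dist x y" using Lip_le_iff[OF K] by blast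
  then show ?thesis by (rule lipschitz_bound_closure[OF AM_extension_continuous[OF v] _ xy])
qed

lemma AM_extension_uminus:
  "AM_extension Y F v \<Longrightarrow> AM_extension Y (\<lambda>x. - F x) (\<lambda>x. - v x)"
proof -
  have "\<bar>- v y - - v x\<bar> = \<bar>v y - v x\<bar>" for x y :: 'a by simp
  then have "Lip W (\<lambda>x. - v x) = Lip W v" for W unfolding Lip_def by metis
  then show "AM_extension Y F v \<Longrightarrow> AM_extension Y (\<lambda>x. - F x) (\<lambda>x. - v x)"
    by (simp add: AM_extension_def)
qed

context tug
begin

text \<open>On the frontier of \<open>{z. v z < m}\<close> the value is \<open>m\<close>, so the
  Lipschitz constant there is 0 and \<open>v\<close> is constant on the closure. A path to
  \<open>Y\<close> shows that the frontier is not empty.\<close>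

lemma AM_extension_ge_m:
  assumes v: "AM_extension Y F v" shows "m \<le> v x"
proof (rule ccontr)
  assume neg: "\<not> m \<le> v x"
  define V where "V = {z. v z < m}"
  note cont = AM_extension_continuous[OF v]
  have V: "open V" unfolding V_def by (rule open_Collect_less[OF cont]) simp
  have vY: "v y = F y" if "y \<in> Y" for y using v that by (simp add: AM_extension_def)
  then have VY: "V \<inter> Y = {}" using F_ge unfolding V_def by fastforce
  have "closure V \<subseteq> {z. v z \<le> m}"
    by (rule closure_minimal) (auto simp: V_def intro!: closed_Collect_le cont)
  then have fr: "v c = m" if "c \<in> frontier V" for c
    using that V by (force simp: frontier_def interior_open V_def)
  obtain y0 where y0: "y0 \<in> Y" using Y_ne by blast
  have x: "x \<in> V" using neg by (simp add: V_def)
  have "y0 \<notin> V" using y0 VY by blast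
  from length_space_near_frontier[OF len x this, of "dist x y0 + 1"]
  obtain c where c: "c \<in> frontier V" by auto
  have "\<bar>v c - v x\<bar> \<le> 0 * dist x c"
    by (rule AM_extension_closure[OF v V VY])
       (use fr c x closure_subset in \<open>auto simp: frontier_def\<close>)
  then show False using fr[OF c] neg by simp
qed

text \<open>
  Comparison with the cone through \<open>x\<close> and the minimum over the ball of radius \<open>2 * \<rho>\<close>: on the set
  where \<open>v\<close> lies below the cone, absolute minimality makes \<open>v\<close> as flat as the cone.
\<close>

lemma AM_extension_superharmonic_on_scales:
  assumes v: "AM_extension Y F v" shows "superharmonic_on_scales v"
  unfolding superharmonic_on_scales_def
proof (intro allI impI)
  fix \<rho> :: real and x z :: 'a
  assume \<rho>: "0 < \<rho>" and far: "\<forall>y\<in>Y. 4 * \<rho> \<le> dist x y" and z: "dist x z < \<rho>"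
  have m: "\<forall>x. m \<le> v x" using AM_extension_ge_m[OF v] by blast
  define g where "g = lo (2 * \<rho>) v x"
  have g_le: "g \<le> v y" if "dist x y < 2 * \<rho>" for y unfolding g_def by (rule lo_le[OF m that])
  \<comment> \<open>The slope for which the cone from height \<open>v x\<close> comes down to
    \<open>g\<close> exactly at distance \<open>2 * \<rho>\<close>. This makes \<open>v\<close> and
    \<open>\<phi>\<close> agree on the frontier of \<open>V\<close> even on that sphere.\<close>
  define \<kappa> where "\<kappa> = (v x - g) / (2 * \<rho>)"
  have \<kappa>: "0 \<le> \<kappa>" "\<kappa> * (2 * \<rho>) = v x - g" using g_le[of x] \<rho> by (simp_all add: \<kappa>_def)
  define \<phi> where "\<phi> = (\<lambda>y. v x - \<kappa> * dist x y)"
  define V where "V = {y. dist x y < 2 * \<rho> \<and> v y < \<phi> y}"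
  note cont = AM_extension_continuous[OF v]
  have cont_\<phi>: "continuous_on UNIV \<phi>" unfolding \<phi>_def by (intro continuous_intros)
  have V: "open V" unfolding V_def
    by (intro open_Collect_conj open_Collect_less cont cont_\<phi> continuous_intros)
  have VY: "V \<inter> Y = {}" using far \<rho> unfolding V_def by force
  have "closure V \<subseteq> {y. dist x y \<le> 2 * \<rho> \<and> v y \<le> \<phi> y \<and> g \<le> v y}"
  proof (rule closure_minimal)
    show "V \<subseteq> {y. dist x y \<le> 2 * \<rho> \<and> v y \<le> \<phi> y \<and> g \<le> v y}" using g_le by (auto simp: V_def)
    show "closed {y. dist x y \<le> 2 * \<rho> \<and> v y \<le> \<phi> y \<and> g \<le> v y}"
      by (intro closed_Collect_conj closed_Collect_le cont cont_\<phi> continuous_intros)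
  qed
  then have fr: "v c = \<phi> c" if "c \<in> frontier V" for c
  proof -
    have c: "dist x c \<le> 2 * \<rho>" "v c \<le> \<phi> c" "g \<le> v c" "c \<notin> V"
      using that V \<open>closure V \<subseteq> _\<close> by (auto simp: frontier_def interior_open)
    show ?thesis
    proof (cases "dist x c < 2 * \<rho>")
      case True
      then show ?thesis using c by (simp add: V_def)
    next
      case False
      then have "dist x c = 2 * \<rho>" using c(1) by simp
      then have "\<phi> c = g" using \<kappa>(2) by (simp add: \<phi>_def)
      then show ?thesis using c by simp
    qed
  qed
  have "\<phi> y \<le> v y" if y: "dist x y < 2 * \<rho>" for y
  proof (rule ccontr)
    assume "\<not> \<phi> y \<le> v y"
    then have yV: "y \<in> V" and gap: "0 < \<phi> y - v y" using y by (auto simp: V_def)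
    \<comment> \<open>An almost shortest path from \<open>y\<close> to \<open>x\<close> meets the
      frontier at some \<open>c\<close> where \<open>v\<close> and \<open>\<phi>\<close> agree.
      Slope at most \<kappa> between \<open>y\<close> and \<open>c\<close> keeps \<open>v y\<close>
      above \<open>\<phi> y - \<kappa> * e\<close>, so \<open>\<kappa> * e\<close> is chosen below
      the gap.\<close>
    define e where "e = (\<phi> y - v y) / (\<kappa> + 1)"
    have e: "0 < e" "\<kappa> * e < \<phi> y - v y" using gap \<kappa>(1) by (simp_all add: e_def field_simps)
    have "x \<notin> V" by (simp add: V_def \<phi>_def)
    moreover have "dist y x < dist y x + e" using e(1) by simp
    ultimately obtain c where c: "c \<in> frontier V" "dist y c + dist c x < dist y x + e"
      using length_space_cross_frontier[OF len yV] by blast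
    have "\<bar>\<phi> b - \<phi> a\<bar> \<le> \<kappa> * dist a b" for a b
    proof -
      have "\<bar>\<phi> b - \<phi> a\<bar> = \<kappa> * \<bar>dist x a - dist x b\<bar>"
        using \<kappa>(1) by (simp add: \<phi>_def abs_mult right_diff_distrib[symmetric])
      also have "\<dots> \<le> \<kappa> * dist a b"
        using abs_dist_diff_le[of a x b] \<kappa>(1) by (intro mult_left_mono) (auto simp: dist_commute)
      finally show ?thesis .
    qed
    then have "\<bar>v b - v a\<bar> \<le> \<kappa> * dist a b" if "a \<in> frontier V" "b \<in> frontier V" for a b
      using fr that by metis
    moreover have "y \<in> closure V" "c \<in> closure V"
      using yV closure_subset[of V] c(1) by (auto simp: frontier_def)
    ultimately have "\<bar>v c - v y\<bar> \<le> \<kappa> * dist y c"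
      by (rule AM_extension_closure[OF v V VY \<kappa>(1)])
    moreover have "\<kappa> * (dist y c + dist c x) \<le> \<kappa> * (dist y x + e)" using c(2) \<kappa>(1) by (intro mult_left_mono) auto
    moreover have "v c = v x - \<kappa> * dist c x" using fr[OF c(1)] by (simp add: \<phi>_def dist_commute)
    moreover have "\<phi> y = v x - \<kappa> * dist y x" by (simp add: \<phi>_def dist_commute)
    ultimately show False using e(2) by (simp add: distrib_left)
  qed
  then have half: "(v x + g) / 2 \<le> v y" if "dist x y < \<rho>" for y
  proof -
    have "\<kappa> * (2 * dist x y) \<le> \<kappa> * (2 * \<rho>)" using that \<kappa>(1) by (intro mult_left_mono) auto
    moreover have "\<phi> y \<le> v y" using \<open>\<And>y. dist x y < 2 * \<rho> \<Longrightarrow> \<phi> y \<le> v y\<close> that \<rho> by simp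
    ultimately show ?thesis using \<kappa>(2) by (simp add: \<phi>_def)
  qed
  have "(v x + g) / 2 \<le> lo \<rho> v x" by (rule lo_greatest[OF \<rho> half])
  moreover have "lo \<rho> v z \<le> v x" by (rule lo_le[OF m]) (use z in \<open>simp add: dist_commute\<close>)
  ultimately show "lo \<rho> v z + lo (2 * \<rho>) v x \<le> 2 * lo \<rho> v x" unfolding g_def by argo
qed

lemma U_le_AM_extension:
  assumes v: "AM_extension Y F v" shows "U x \<le> v x"
proof -
  obtain K where K: "0 \<le> K" "\<And>x y. \<bar>v y - v x\<bar> \<le> K * dist x y" using AM_extension_lipschitz[OF v] by blast
  have m: "\<forall>x. m \<le> v x" using AM_extension_ge_m[OF v] by blast
  have F: "F y - K * dist x y \<le> v x" if "y \<in> Y" for x y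
    using K(2)[of y x] v that by (simp add: AM_extension_def)
  show ?thesis
  proof (rule field_le_epsilon)
    fix e :: real assume e: "0 < e"
    define D where "D = 5 * (K + L) + 12 * L"
    have D: "0 < D" using K(1) L_pos by (simp add: D_def)
    define s where "s = e / D"
    have s: "0 < s" "D * s = e" using D e by (simp_all add: s_def)
    have "u s x \<le> v x + 5 * (K + L) * s"
      by (rule u_le_of_superharmonic_on_scales[OF AM_extension_superharmonic_on_scales[OF v] m K(1) F s(1)])
    moreover have "U x \<le> u s x + 12 * L * s" using u_near_U[OF s(1), of x] by simp
    moreover have "5 * (K + L) * s + 12 * L * s = e" using s(2) by (simp add: D_def distrib_right)
    ultimately show "U x \<le> v x + e" by linarith
  qed
qed

text \<open>The comparison principle, with \<open>w\<close> in the role of a supersolution for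
  \<open>-F\<close>. Since a negative infimum of the sum need not be attained, one summand is first
  made strict.\<close>

lemma superharmonic_sum_nonneg:
  assumes s: "0 < s" and W: "W \<in> supersolutions s" and m': "\<forall>x. m' \<le> w x"
    and sh: "\<And>x. x \<notin> Y \<Longrightarrow> superharmonic_at s w x" and wF: "\<And>y. y \<in> Y \<Longrightarrow> - F y \<le> w y"
  shows "0 \<le> W x0 + w x0"
proof (rule ccontr)
  assume "\<not> 0 \<le> W x0 + w x0"
  then have \<eta>0: "0 < - (W x0 + w x0) / 2" by simp
  obtain W' \<delta> where W': "W' \<in> supersolutions s" and \<delta>: "0 < \<delta>" and W'0: "W' x0 \<le> W x0 + - (W x0 + w x0) / 2"
    and down: "\<And>x. x \<notin> Y \<Longrightarrow> lo s W' x \<le> W' x - \<delta>"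
    using strict_supersolution[OF s W \<eta>0] by metis
  note mW' = supersolutionsD(1)[OF W'] and shW' = supersolutionsD(3)[OF W']
  define \<theta> where "\<theta> = (INF x. W' x + w x)"
  have "bdd_below (range (\<lambda>x. W' x + w x))"
    by (rule bdd_belowI[of _ "m + m'"]) (use mW' m' in \<open>auto intro: add_mono\<close>)
  then have \<theta>_le: "\<theta> \<le> W' x + w x" for x unfolding \<theta>_def by (rule cINF_lower) simp
  have \<theta>_neg: "\<theta> < 0" using \<theta>_le[of x0] W'0 \<open>\<not> 0 \<le> W x0 + w x0\<close> by argo
  have near: "\<exists>x. W' x + w x < \<theta> + \<eta>" if "0 < \<eta>" for \<eta>
  proof (rule ccontr)
    assume "\<not> ?thesis"
    then have "\<theta> + \<eta> \<le> \<theta>" unfolding \<theta>_def by (intro cINF_greatest) (auto simp: not_less)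
    then show False using that by simp
  qed
  \<comment> \<open>Near a minimum of \<open>W' + w\<close> the descent of \<open>W'\<close> forces an ascent of \<open>w\<close>, hence a descent
    of \<open>w\<close> to another point near the minimum.\<close>
  have "\<exists>x. W' x + w x < \<theta> + \<eta> \<and> w x \<le> \<theta> + 1 - m - real k * (\<delta> / 2)" if "0 < \<eta>" for k \<eta>
    using that
  proof (induction k arbitrary: \<eta>)
    case 0
    then obtain x where x: "W' x + w x < \<theta> + min \<eta> 1" using near[of "min \<eta> 1"] by auto
    have "m \<le> W' x" using mW' by blast
    then show ?case using x by (intro exI[of _ x]) auto
  next
    case (Suc k)
    \<comment> \<open>\<open>- \<theta>\<close> keeps \<open>x\<close> off \<open>Y\<close>, where
      the sum is nonnegative. Three errors \<epsilon> enter the descent of \<open>w\<close>, four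
      enter the distance to the infimum.\<close>
    define \<epsilon> where "\<epsilon> = min (\<eta> / 4) (min (\<delta> / 6) (- \<theta>))"
    have \<epsilon>: "0 < \<epsilon>" "4 * \<epsilon> \<le> \<eta>" "3 * \<epsilon> \<le> \<delta> / 2" "\<theta> + \<epsilon> \<le> 0"
      using Suc.prems \<delta> \<theta>_neg by (auto simp: \<epsilon>_def)
    obtain x where x: "W' x + w x < \<theta> + \<epsilon>" "w x \<le> \<theta> + 1 - m - real k * (\<delta> / 2)"
      using Suc.IH[OF \<epsilon>(1)] by blast
    have xY: "x \<notin> Y" using x(1) \<epsilon>(4) wF[of x] supersolutionsD(2)[OF W', of x] by fastforce
    obtain p where p: "dist x p < s" "W' p < lo s W' x + \<epsilon>" using lo_less[OF s, of W' x "lo s W' x + \<epsilon>"] \<epsilon>(1) by auto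
    obtain y where y: "dist x y < s" "w y < lo s w x + \<epsilon>" using lo_less[OF s, of w x "lo s w x + \<epsilon>"] \<epsilon>(1) by auto
    have wp: "w p + lo s w x \<le> 2 * w x" by (rule superharmonic_atD[OF sh[OF xY] p(1)])
    have Wy: "W' y + lo s W' x \<le> 2 * W' x" by (rule superharmonic_atD[OF shW'[OF xY] y(1)])
    have "w y \<le> w x - \<delta> / 2"
      using y(2) wp \<theta>_le[of p] p(2) down[OF xY] x(1) \<epsilon>(3) by linarith
    moreover have "W' y + w y < \<theta> + \<eta>"
      using y(2) wp Wy \<theta>_le[of p] p(2) x(1) \<epsilon>(2) by linarith
    moreover have "real (Suc k) * (\<delta> / 2) = real k * (\<delta> / 2) + \<delta> / 2" by (simp add: distrib_right)
    ultimately show ?case using x(2) by (intro exI[of _ y] conjI) linarith+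
  qed
  moreover obtain k where "\<theta> + 1 - m - m' < real k * (\<delta> / 2)"
    using reals_Archimedean3[OF half_gt_zero[OF \<delta>]] by blast
  ultimately obtain x where "w x < m'" by (smt (verit) zero_less_one)
  then show False using m' by (simp add: not_less[symmetric])
qed

text \<open>The upper bound on \<open>F\<close> bounds \<open>-F\<close> below, so the same theory
  yields \<open>U \<le> v \<le> - neg.U\<close>; the comparison principle closes the gap.\<close>

lemma AM_extension_unique:
  assumes bdd: "\<And>y. y \<in> Y \<Longrightarrow> F y \<le> M" and v: "AM_extension Y F v"
  shows "v = U"
proof
  fix x
  interpret neg: tug Y "\<lambda>y. - F y" L "- M"
  proof
    show "L-lipschitz_on Y (\<lambda>y. - F y)"
      using F_lip by (auto simp: lipschitz_on_def dist_real_def abs_minus_commute)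
  qed (use len Y_ne L_pos bdd in auto)
  have "0 \<le> U x + neg.U x"
  proof (rule field_le_epsilon)
    fix e :: real assume e: "0 < e"
    define s where "s = e / (24 * L)"
    have s: "0 < s" "24 * L * s = e" using e L_pos by (simp_all add: s_def)
    have "0 \<le> u s x + neg.u s x"
    proof (rule superharmonic_sum_nonneg[OF s(1) u_supersolution[OF s(1)] neg.u_ge[OF s(1)]])
      show "- F y \<le> neg.u s y" if "y \<in> Y" for y using neg.u_eq_F[OF s(1) that] by simp
    qed (rule neg.u_superharmonic[OF s(1)])
    then show "0 \<le> U x + neg.U x + e"
      using u_near_U[OF s(1), of x] neg.u_near_U[OF s(1), of x] s(2) by linarith
  qed
  moreover have "neg.U x \<le> - v x" by (rule neg.U_le_AM_extension[OF AM_extension_uminus[OF v]])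
  moreover have "U x \<le> v x" by (rule U_le_AM_extension[OF v])
  ultimately show "v x = U x" by simp
qed

end

theorem theorem1p4:
  fixes Y :: "'a::metric_space set" and F :: "'a \<Rightarrow> real"
  assumes "length_space TYPE('a)"
    and "Y \<noteq> {}"
    and "\<exists>L. L-lipschitz_on Y F"
    and "bdd_below (F ` Y)"
  shows "\<exists>u. is_continuum_value Y F u \<and> AM_extension Y F u \<and>
           (bounded (F ` Y) \<longrightarrow> (\<forall>v. AM_extension Y F v \<longrightarrow> v = u))"
proof -
  obtain L where L: "L-lipschitz_on Y F" using assms(3) by blast
  obtain m where m: "\<And>y. y \<in> Y \<Longrightarrow> m \<le> F y" using assms(4) by (auto simp: bdd_below_def)
  \<comment> \<open>For constant \<open>F\<close> the given Lipschitz constant may be 0; enlarging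
    it to at least 1 makes it positive.\<close>
  interpret tug Y F "max L 1" m
    by unfold_locales (use assms(1,2) m lipschitz_on_mono[OF L subset_refl] in auto)
  have "v = U" if bdd: "bounded (F ` Y)" and v: "AM_extension Y F v" for v
  proof -
    obtain M where M: "\<And>y. y \<in> Y \<Longrightarrow> \<bar>F y\<bar> \<le> M" using bdd by (auto simp: bounded_iff)
    show ?thesis by (rule AM_extension_unique[OF _ v]) (use M in \<open>auto simp: abs_le_iff\<close>)
  qed
  then show ?thesis using is_continuum_value_U AM_extension_U by blast
qed

end
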